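(* Let $X,Y$ be real Banach spaces, and let $\mathcal{T}(t)P:=S^*(t)PT(t)$ be the semigroup on $\mathcal{B}(X,Y^* )$ implemented by $C_0$ semigroups $T(t)$ and $S(t)$ on $X$ and $Y$ respectively, with generators $A$ and $B$ respectively. Define $\mathcal{A}P:=\overline{B^*P+PA}$ (the bar stands for closure) on the domain $$\mathcal{D}_{\mathcal{A}}:=\{P\in\mathcal{B}(X,Y^* )\ |\ P(\mathcal{D}_A)\subseteq\mathcal{D}_{B^*},\ \|B^*P+PA\|<\infty\}.$$ Then: (i) $P\in\mathcal{B}(X,Y^* )$ belongs to $\mathcal{D}_{\mathcal{A}}$ if and only if there exists a bounded operator $Q\in\mathcal{B}(X,Y^* )$ such that $\langle Px,By\rangle+\langle PAx,y\rangle=\langle Qx,y\rangle$ for all $x\in\mathcal{D}_A$ and $y\in\mathcal{D}_B$, in which case $\mathcal{A}P=Q$; (ii) $\mathcal{A}^{\mathrm{wo}*}=\mathcal{A}$ (equality of operators, including domains); (iii) if additionally $Y$ is reflexive, then $\mathcal{A}^{\mathrm{so}}=\mathcal{A}$.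
   Context: $\mathcal{B}(X,Y^* )$ is the Banach space of bounded linear operators from $X$ to the dual $Y^*$; $\langle\cdot,\cdot\rangle$ is the duality pairing between $Y^*$ and $Y$. $\mathcal{D}_A,\mathcal{D}_B$ are the domains of $A,B$, and $B^*$ is the Banach space adjoint of $B$ with domain $\mathcal{D}_{B^*}\subseteq Y^*$. The operator $B^*P+PA$ is defined on $\mathcal{D}_A$; $\|B^*P+PA\|<\infty$ means it is bounded on $\mathcal{D}_A$ with respect to the norms of $X$ and $Y^*$, and then its closure is its unique bounded extension to $X$. For a topology $\tau$ on $\mathcal{B}(X,Y^* )$, the $\tau$-generator of $\mathcal{T}(t)$ is $\mathcal{A}^{\tau}P:=\tau\text{-}\lim_{t\to0^+}\frac1t(\mathcal{T}(t)P-P)$ on the domain $\mathcal{D}_{\mathcal{A}^\tau}$ of all $P\in\mathcal{B}(X,Y^* )$ for which this limit exists in $\mathcal{B}(X,Y^* )$. The weak operator* topology (wo* ) is given by the seminorms $R\mapsto|\langle Rx,y\rangle|$, $x\in X$, $y\in Y$; the strong operator topology (so) is given by the seminorms $R\mapsto\|Rx\|$, $x\in X$. *)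

theory Defs
  imports "HOL-Analysis.Analysis"
begin

text \<open>
  The (real) dual of a space \<open>'b\<close> is the Banach space \<open>'b \<Rightarrow>\<^sub>L real\<close>, and the pairing
  \<open>\<langle>f, y\<rangle>\<close> is application \<open>f y\<close>.

  Unbounded operators are partial functions: \<open>dom F\<close> is the domain, \<open>the (F x)\<close> is the value
  at a point of the domain. Equality of such maps is equality of operators including domains.
\<close>

type_synonym 'b dual = "'b \<Rightarrow>\<^sub>L real"

text \<open>Only the values of \<open>T\<close> at \<open>t \<ge> 0\<close> matter.\<close>

definition C0_semigroup :: "(real \<Rightarrow> ('a::real_normed_vector \<Rightarrow>\<^sub>L 'a)) \<Rightarrow> bool" where
  "C0_semigroup T \<longleftrightarrow>
     T 0 = id_blinfun \<and>
     (\<forall>s\<ge>0. \<forall>t\<ge>0. T (s + t) = T s o\<^sub>L T t) \<and>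
     (\<forall>x. ((\<lambda>t. blinfun_apply (T t) x) \<longlongrightarrow> x) (at_right 0))"

text \<open>
  The generator of a family of maps with respect to a topology. The description operator is only
  meaningful when limits are unique, which holds for the (Hausdorff) topologies used below.
\<close>

definition generator_wrt ::
    "'v topology \<Rightarrow> (real \<Rightarrow> 'v \<Rightarrow> 'v) \<Rightarrow> ('v::real_vector \<rightharpoonup> 'v)" where
  "generator_wrt \<tau> U v =
     (if \<exists>w. limitin \<tau> (\<lambda>t. (1 / t) *\<^sub>R (U t v - v)) w (at_right 0)
      then Some (THE w. limitin \<tau> (\<lambda>t. (1 / t) *\<^sub>R (U t v - v)) w (at_right 0))
      else None)"

definition generator ::
    "(real \<Rightarrow> ('a::real_normed_vector \<Rightarrow>\<^sub>L 'a)) \<Rightarrow> ('a \<rightharpoonup> 'a)" where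
  "generator T = generator_wrt euclidean (\<lambda>t. blinfun_apply (T t))"

text \<open>
  The coarsest translation-invariant topology making each of the given seminorms continuous.
\<close>

definition seminorm_topology :: "('v::real_vector \<Rightarrow> real) set \<Rightarrow> 'v topology" where
  "seminorm_topology \<P> =
     topology_generated_by {{v. p (v - v0) < \<epsilon>} | p v0 \<epsilon>. p \<in> \<P> \<and> \<epsilon> > 0}"

definition weak_star_operator_topology ::
    "('a::real_normed_vector \<Rightarrow>\<^sub>L 'b::real_normed_vector dual) topology" where
  "weak_star_operator_topology =
     seminorm_topology (range (\<lambda>(x, y). \<lambda>R. \<bar>blinfun_apply (blinfun_apply R x) y\<bar>))"

definition blinfun_adjoint ::
    "('b::real_normed_vector \<Rightarrow>\<^sub>L 'c::real_normed_vector) \<Rightarrow> ('c dual \<Rightarrow>\<^sub>L 'b dual)" where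
  "blinfun_adjoint S = Blinfun (\<lambda>f. f o\<^sub>L S)"

lemma blinfun_adjoint_apply [simp]: "blinfun_apply (blinfun_adjoint S) f = f o\<^sub>L S"
  unfolding blinfun_adjoint_def
  by (simp add: bounded_linear_Blinfun_apply
      bounded_bilinear.bounded_linear_left[OF bounded_bilinear_blinfun_compose])

definition implemented_semigroup ::
    "(real \<Rightarrow> ('a::real_normed_vector \<Rightarrow>\<^sub>L 'a)) \<Rightarrow> (real \<Rightarrow> ('b::real_normed_vector \<Rightarrow>\<^sub>L 'b)) \<Rightarrow>
     real \<Rightarrow> ('a \<Rightarrow>\<^sub>L 'b dual) \<Rightarrow> ('a \<Rightarrow>\<^sub>L 'b dual)" where
  "implemented_semigroup T S t P = blinfun_adjoint (S t) o\<^sub>L P o\<^sub>L T t"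

text \<open>
  The adjoint of an unbounded operator; the value is unique when the operator is densely defined,
  as generators of \<open>C\<^sub>0\<close> semigroups are.
\<close>

definition adjoint_op ::
    "('b::real_normed_vector \<rightharpoonup> 'c::real_normed_vector) \<Rightarrow> ('c dual \<rightharpoonup> 'b dual)" where
  "adjoint_op B f =
     (if \<exists>g::'b dual. \<forall>y\<in>dom B. blinfun_apply f (the (B y)) = blinfun_apply g y
      then Some (THE g::'b dual. \<forall>y\<in>dom B. blinfun_apply f (the (B y)) = blinfun_apply g y)
      else None)"

text \<open>
  The operator \<open>B\<^sup>* P + P A\<close>. Its domain is all of \<open>dom A\<close> whenever \<open>P\<close> maps \<open>dom A\<close> into the
  domain of \<open>B\<^sup>*\<close>, which is the only case in which it is used.
\<close>

definition lyapunov_op ::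
    "('a::real_normed_vector \<rightharpoonup> 'a) \<Rightarrow> ('b::real_normed_vector \<rightharpoonup> 'b) \<Rightarrow>
     ('a \<Rightarrow>\<^sub>L 'b dual) \<Rightarrow> ('a \<rightharpoonup> 'b dual)" where
  "lyapunov_op A B P x =
     (if x \<in> dom A \<and> blinfun_apply P x \<in> dom (adjoint_op B)
      then Some (the (adjoint_op B (blinfun_apply P x)) + blinfun_apply P (the (A x)))
      else None)"

definition bounded_op :: "('a::real_normed_vector \<rightharpoonup> 'b::real_normed_vector) \<Rightarrow> bool" where
  "bounded_op F \<longleftrightarrow> (\<exists>C. \<forall>x\<in>dom F. norm (the (F x)) \<le> C * norm x)"

text \<open>The closure of a closable operator: its graph is the closure of the graph.\<close>

definition closure_op ::
    "('a::real_normed_vector \<rightharpoonup> 'b::real_normed_vector) \<Rightarrow> ('a \<rightharpoonup> 'b)" where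
  "closure_op F = (THE G. Map.graph G = closure (Map.graph F))"

text \<open>
  The operator \<open>P \<mapsto> closure (B\<^sup>* P + P A)\<close>. On its domain the closure is everywhere defined and
  bounded, and the description operator just turns this partial function into the corresponding
  element of \<open>'a \<Rightarrow>\<^sub>L 'b dual\<close>.
\<close>

definition lyapunov_generator ::
    "('a::real_normed_vector \<rightharpoonup> 'a) \<Rightarrow> ('b::real_normed_vector \<rightharpoonup> 'b) \<Rightarrow>
     (('a \<Rightarrow>\<^sub>L 'b dual) \<rightharpoonup> ('a \<Rightarrow>\<^sub>L 'b dual))" where
  "lyapunov_generator A B P =
     (if blinfun_apply P ` dom A \<subseteq> dom (adjoint_op B) \<and> bounded_op (lyapunov_op A B P)
      then Some (THE Q. (\<lambda>x. Some (blinfun_apply Q x)) = closure_op (lyapunov_op A B P))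
      else None)"

definition canonical_embedding :: "'b::real_normed_vector \<Rightarrow> 'b dual dual" where
  "canonical_embedding y = Blinfun (\<lambda>f. blinfun_apply f y)"

lemma canonical_embedding_apply [simp]:
  "blinfun_apply (canonical_embedding y) f = blinfun_apply f y"
  unfolding canonical_embedding_def
  by (simp add: bounded_linear_Blinfun_apply blinfun.bounded_linear_left)

definition reflexive_space :: "'b::real_normed_vector itself \<Rightarrow> bool" where
  "reflexive_space _ \<longleftrightarrow> surj (canonical_embedding :: 'b \<Rightarrow> 'b dual dual)"

end

theory Submission
  imports Defs
begin

text \<open>
  Part (i) holds because \<open>D\<^sub>A\<close> and \<open>D\<^sub>B\<close> are dense. If the quotients \<open>R\<^sub>t = (T(t)P - P)/t\<close> of the implemented
  semigroup converge weakly-star to \<open>Q\<close>, differentiating \<open>\<langle>P T(t) x, S(t) y\<rangle>\<close> at \<open>0\<close> by the product rule gives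
  the identity of (i). Conversely, this identity and the invariance of the domains give
  \<open>d/dt \<langle>P T(t) x, S(t) y\<rangle> = \<langle>Q T(t) x, S(t) y\<rangle>\<close> for \<open>x \<in> D\<^sub>A\<close>, \<open>y \<in> D\<^sub>B\<close>, so by the mean value inequality
  \<open>\<bar>\<langle>R\<^sub>t x - Q x, y\<rangle>\<bar> \<le> sup {\<bar>\<langle>Q T(s) x, S(s) y\<rangle> - \<langle>Q x, y\<rangle>\<bar> | s \<le> t}\<close>, and by density this holds for all \<open>x\<close>, \<open>y\<close>.
  Weak-star convergence follows, and strong convergence as soon as the adjoint semigroup is strongly
  continuous. The functionals at which it is strongly continuous form a closed subspace containing every
  functional of the form \<open>z \<mapsto> f (\<integral>\<^sub>0\<^sup>h S(s) z ds)\<close>. If \<open>Y\<close> is reflexive and this subspace is proper, Hahn--Banach yields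
  a nonzero \<open>y\<close> annihilated by all these functionals; dividing by \<open>h\<close> and letting \<open>h\<close> tend to \<open>0\<close> gives \<open>f y = 0\<close>
  for every \<open>f\<close>, a contradiction.
\<close>

subsection \<open>Uniform boundedness\<close>

text \<open>By Baire, one of the closed sets \<open>E k\<close>, which cover the space by pointwise
  boundedness, contains a ball. Every small vector is a difference of two points of that ball, which
  bounds all of \<open>F\<close> at once.\<close>

lemma uniform_boundedness:
  fixes F :: "('a::banach \<Rightarrow>\<^sub>L 'b::real_normed_vector) set"
  assumes pointwise: "\<And>x. \<exists>C. \<forall>f\<in>F. norm (blinfun_apply f x) \<le> C"
  shows "\<exists>C. \<forall>f\<in>F. norm f \<le> C"
proof -
  define E where "E k = {x. \<forall>f\<in>F. norm (blinfun_apply f x) \<le> real k}" for k :: nat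
  have E_eq: "E k = (\<Inter>f\<in>F. {x. norm (blinfun_apply f x) \<le> real k})" for k
    by (auto simp: E_def)
  have closed_E: "closed (E k)" for k
    unfolding E_eq by (intro closed_INT ballI closed_Collect_le continuous_intros)
  have "x \<in> \<Union>(range E)" for x
  proof -
    obtain C where "\<forall>f\<in>F. norm (blinfun_apply f x) \<le> C" using pointwise by blast
    moreover obtain k :: nat where "C \<le> real k" using real_arch_simple by blast
    ultimately have "x \<in> E k" unfolding E_def by force
    then show ?thesis by blast
  qed
  then have "\<Union>(range E) = UNIV" by blast
  moreover have "interior (\<Union>(range E)) = {}" if "\<And>k. interior (E k) = {}"
  proof -
    have "euclidean interior_of \<Union>(range E) = {}"
      by (rule Baire_category_alt) (use that closed_E completely_metrizable_space_euclidean in auto)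
    then show ?thesis by simp
  qed
  ultimately obtain k where "interior (E k) \<noteq> {}" by force
  then obtain x0 r where r: "r > 0" and ball: "cball x0 r \<subseteq> E k"
    by (metis all_not_in_conv mem_interior_cball)
  have "norm f \<le> 2 * real k / r" if f: "f \<in> F" for f
  proof (rule norm_blinfun_bound)
    show "0 \<le> 2 * real k / r" using r by simp
    fix x
    show "norm (blinfun_apply f x) \<le> 2 * real k / r * norm x"
    proof (cases "x = 0")
      case False
      define y where "y = (r / norm x) *\<^sub>R x"
      have "norm y = r" using False r by (simp add: y_def)
      then have "x0 + y \<in> E k" "x0 \<in> E k"
        using ball r by (auto simp: subset_iff dist_norm)
      then have "norm (blinfun_apply f (x0 + y)) \<le> k" "norm (blinfun_apply f x0) \<le> k"
        using f by (auto simp: E_def)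
      moreover have "blinfun_apply f y = blinfun_apply f (x0 + y) - blinfun_apply f x0"
        by (simp add: blinfun.add_right)
      ultimately have "norm (blinfun_apply f y) \<le> 2 * k"
        using norm_triangle_ineq4[of "blinfun_apply f (x0 + y)" "blinfun_apply f x0"] by simp
      then have "(r / norm x) * norm (blinfun_apply f x) \<le> 2 * k"
        using r by (simp add: y_def blinfun.scaleR_right)
      then show ?thesis using False r by (simp add: field_simps)
    qed simp
  qed
  then show ?thesis by blast
qed

subsection \<open>Hahn--Banach by minimal sublinear functionals\<close>

text \<open>Homogeneity is an inequality for positive \<open>c\<close> only, which is easy to verify
  for infima and distances. Equality for all \<open>c \<ge> 0\<close> is recovered in
  \<open>sublinear_scaleR\<close>.\<close>

definition sublinear :: "('v::real_vector \<Rightarrow> real) \<Rightarrow> bool" where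
  "sublinear p \<longleftrightarrow> (\<forall>x y. p (x + y) \<le> p x + p y) \<and> (\<forall>c>0. \<forall>x. p (c *\<^sub>R x) \<le> c * p x)"

lemma sublinear_add: "sublinear p \<Longrightarrow> p (x + y) \<le> p x + p y"
  by (simp add: sublinear_def)

lemma sublinear_zero: "sublinear p \<Longrightarrow> p 0 = 0"
proof -
  assume p: "sublinear p"
  have "p 0 \<le> p 0 + p 0" using sublinear_add[OF p, of 0 0] by simp
  moreover have "p ((1/2) *\<^sub>R 0) \<le> (1/2) * p 0"
    using p unfolding sublinear_def by (meson half_gt_zero_iff zero_less_one)
  ultimately show ?thesis by simp
qed

lemma sublinear_scaleR:
  assumes p: "sublinear p" and c: "c \<ge> 0"
  shows "p (c *\<^sub>R x) = c * p x"
proof (cases "c = 0")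
  case False
  then have c: "c > 0" using c by simp
  have "p (inverse c *\<^sub>R (c *\<^sub>R x)) \<le> inverse c * p (c *\<^sub>R x)"
    using p c unfolding sublinear_def by (meson positive_imp_inverse_positive)
  then have "c * p x \<le> p (c *\<^sub>R x)" using c by (simp add: field_simps)
  moreover have "p (c *\<^sub>R x) \<le> c * p x" using p c by (simp add: sublinear_def)
  ultimately show ?thesis by simp
qed (simp add: sublinear_zero[OF p])

lemma sublinear_minus: "sublinear p \<Longrightarrow> - p (- x) \<le> p x"
  using sublinear_add[of p x "- x"] sublinear_zero[of p] by simp

text \<open>
  A sublinear functional \<open>p\<close> with \<open>sublinear_shift p z = p\<close> is odd at \<open>z\<close>; as the shift only decreases \<open>p\<close>,
  minimal sublinear functionals are linear.
\<close>

definition sublinear_shift :: "('v::real_vector \<Rightarrow> real) \<Rightarrow> 'v \<Rightarrow> 'v \<Rightarrow> real" where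
  "sublinear_shift p z x = (INF t\<in>{0..}. p (x + t *\<^sub>R z) - t * p z)"

lemma sublinear_shift_le:
  assumes p: "sublinear p" and t: "t \<ge> 0"
  shows "sublinear_shift p z x \<le> p (x + t *\<^sub>R z) - t * p z"
  unfolding sublinear_shift_def
proof (rule cINF_lower)
  \<comment> \<open>A lower bound independent of \<open>s\<close>, from subadditivity applied to
    \<open>s *\<^sub>R z = (x + s *\<^sub>R z) + (- x)\<close>; it makes the real-valued infimum
    meaningful.\<close>
  have "- p (- x) \<le> p (x + s *\<^sub>R z) - s * p z" if "s \<ge> 0" for s
    using sublinear_add[OF p, of "x + s *\<^sub>R z" "- x"] sublinear_scaleR[OF p that, of z] by simp
  then show "bdd_below ((\<lambda>t. p (x + t *\<^sub>R z) - t * p z) ` {0..})"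
    by (auto intro!: bdd_belowI2[where m = "- p (- x)"])
qed (use t in auto)

lemma sublinear_shift_greatest:
  "(\<And>t. t \<ge> 0 \<Longrightarrow> m \<le> p (x + t *\<^sub>R z) - t * p z) \<Longrightarrow> m \<le> sublinear_shift p z x"
  unfolding sublinear_shift_def by (rule cINF_greatest) auto

text \<open>Parameters \<open>s\<close> for \<open>x\<close> and \<open>t\<close> for
  \<open>y\<close> combine to the parameter \<open>s + t\<close> for \<open>x + y\<close>, and
  scaling by \<open>c\<close> turns \<open>t\<close> into \<open>c * t\<close>; then infima are
  taken.\<close>

lemma sublinear_shift:
  assumes p: "sublinear p"
  shows "sublinear (sublinear_shift p z)"
  unfolding sublinear_def
proof (intro conjI allI impI)
  fix x y
  have *: "sublinear_shift p z (x + y) - (p (x + s *\<^sub>R z) - s * p z) \<le> p (y + t *\<^sub>R z) - t * p z"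
    if "s \<ge> 0" "t \<ge> 0" for s t
    using sublinear_shift_le[OF p, of "s + t" z "x + y"] that
      sublinear_add[OF p, of "x + s *\<^sub>R z" "y + t *\<^sub>R z"]
    by (simp add: algebra_simps)
  have "sublinear_shift p z (x + y) - sublinear_shift p z y \<le> p (x + s *\<^sub>R z) - s * p z"
    if "s \<ge> 0" for s
    using sublinear_shift_greatest[of _ p y z, OF *[OF that]] by fastforce
  then show "sublinear_shift p z (x + y) \<le> sublinear_shift p z x + sublinear_shift p z y"
    using sublinear_shift_greatest[of "sublinear_shift p z (x + y) - sublinear_shift p z y" p x z]
    by fastforce
next
  fix c :: real and x
  assume c: "c > 0"
  have "sublinear_shift p z (c *\<^sub>R x) / c \<le> p (x + t *\<^sub>R z) - t * p z" if "t \<ge> 0" for t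
  proof -
    have "p (c *\<^sub>R x + (c * t) *\<^sub>R z) = c * p (x + t *\<^sub>R z)"
      using sublinear_scaleR[OF p, of c "x + t *\<^sub>R z"] c by (simp add: algebra_simps)
    then have "sublinear_shift p z (c *\<^sub>R x) \<le> c * (p (x + t *\<^sub>R z) - t * p z)"
      using sublinear_shift_le[OF p, of "c * t" z "c *\<^sub>R x"] c that by (simp add: algebra_simps)
    then show ?thesis using c by (simp add: field_simps)
  qed
  then have "sublinear_shift p z (c *\<^sub>R x) / c \<le> sublinear_shift p z x"
    by (rule sublinear_shift_greatest)
  then show "sublinear_shift p z (c *\<^sub>R x) \<le> c * sublinear_shift p z x"
    using c by (simp add: field_simps)
qed

text \<open>The choice \<open>t = 1\<close>. If the shift equals \<open>p\<close>, this is the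
  inequality \<open>p (- z) \<le> - p z\<close> that sublinearity alone does not give.\<close>

lemma sublinear_shift_uminus:
  assumes p: "sublinear p"
  shows "sublinear_shift p z (- z) \<le> - p z"
  using sublinear_shift_le[OF p, of 1 z "- z"] sublinear_zero[OF p] by simp

text \<open>The common upper bound \<open>p\<close> yields the lower bound \<open>- p (- x)\<close>
  at each point, so the infima exist. Subadditivity survives because two members of a chain always
  have the smaller one below both.\<close>

lemma sublinear_INF:
  assumes C: "C \<noteq> {}" "\<And>q. q \<in> C \<Longrightarrow> sublinear q" "\<And>q. q \<in> C \<Longrightarrow> q \<le> p"
    and chain: "\<And>q r. q \<in> C \<Longrightarrow> r \<in> C \<Longrightarrow> q \<le> r \<or> r \<le> q"
  shows "sublinear (\<lambda>x. INF q\<in>C. q x)" "\<And>r. r \<in> C \<Longrightarrow> (\<lambda>x. INF q\<in>C. q x) \<le> r"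
proof -
  have bdd: "bdd_below ((\<lambda>q. q x) ` C)" for x
  proof (rule bdd_belowI2)
    fix q assume "q \<in> C"
    then show "- p (- x) \<le> q x"
      using sublinear_minus[of q x] C(2,3) le_funD[of q p "- x"] by fastforce
  qed
  have lower: "(INF q\<in>C. q x) \<le> r x" if "r \<in> C" for r x
    by (rule cINF_lower[OF bdd that])
  then show "\<And>r. r \<in> C \<Longrightarrow> (\<lambda>x. INF q\<in>C. q x) \<le> r" by (simp add: le_fun_def)
  show "sublinear (\<lambda>x. INF q\<in>C. q x)"
    unfolding sublinear_def
  proof (intro conjI allI impI)
    fix x y
    have *: "(INF q\<in>C. q (x + y)) - q x \<le> r y" if "q \<in> C" "r \<in> C" for q r
    proof -
      \<comment> \<open>Subadditivity of the single functional \<open>m\<close> bounds mixed sums of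
        values of \<open>q\<close> and \<open>r\<close>.\<close>
      define m where "m = (if q \<le> r then q else r)"
      then have m: "m \<in> C" "m \<le> q" "m \<le> r" using chain[of q r] that by auto
      have "(INF q\<in>C. q (x + y)) \<le> m (x + y)" by (rule lower[OF m(1)])
      also have "\<dots> \<le> m x + m y" using C(2) m(1) sublinear_add by blast
      also have "\<dots> \<le> q x + r y" using m(2,3) by (intro add_mono) (auto dest: le_funD)
      finally show ?thesis by simp
    qed
    have "(INF q\<in>C. q (x + y)) - q x \<le> (INF q\<in>C. q y)" if "q \<in> C" for q
      using * that C(1) by (intro cINF_greatest) auto
    then have "(INF q\<in>C. q (x + y)) - (INF q\<in>C. q y) \<le> q x" if "q \<in> C" for q
      using that by force
    then have "(INF q\<in>C. q (x + y)) - (INF q\<in>C. q y) \<le> (INF q\<in>C. q x)"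
      using C(1) by (intro cINF_greatest) auto
    then show "(INF q\<in>C. q (x + y)) \<le> (INF q\<in>C. q x) + (INF q\<in>C. q y)" by simp
  next
    fix c :: real and x
    assume c: "c > 0"
    have "(INF q\<in>C. q (c *\<^sub>R x)) / c \<le> q x" if "q \<in> C" for q
      using lower[OF that, of "c *\<^sub>R x"] sublinear_scaleR[OF C(2)[OF that], of c x] c
      by (simp add: field_simps)
    then have "(INF q\<in>C. q (c *\<^sub>R x)) / c \<le> (INF q\<in>C. q x)"
      using C(1) by (intro cINF_greatest) auto
    then show "(INF q\<in>C. q (c *\<^sub>R x)) \<le> c * (INF q\<in>C. q x)" using c by (simp add: field_simps)
  qed
qed

lemma minimal_sublinear_exists:
  assumes p: "sublinear p"
  obtains m where "sublinear m" "m \<le> p" "\<And>q. sublinear q \<Longrightarrow> q \<le> m \<Longrightarrow> q = m"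
proof -
  \<comment> \<open>The order is reversed: the maximal elements that Zorn's lemma provides are
    minimal functionals, and an upper bound of a chain is its infimum, or \<open>p\<close> for the
    empty chain.\<close>
  let ?A = "{q. sublinear q \<and> q \<le> p}" and ?P = "\<lambda>q r :: 'a \<Rightarrow> real. r \<le> q"
  have "\<exists>m\<in>?A. \<forall>q\<in>?A. ?P m q \<longrightarrow> q = m"
  proof (rule predicate_Zorn)
    show "partial_order_on ?A (relation_of ?P ?A)"
      by (rule partial_order_on_relation_ofI) auto
    fix C assume C: "C \<in> Chains (relation_of ?P ?A)"
    have sub: "C \<subseteq> ?A" and chain: "q \<le> r \<or> r \<le> q" if "q \<in> C" "r \<in> C" for q r
      using C that unfolding Chains_def relation_of_def by auto
    show "\<exists>u\<in>?A. \<forall>q\<in>C. ?P q u"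
    proof (cases "C = {}")
      case True
      then show ?thesis using p by auto
    next
      case False
      then have sub: "C \<subseteq> ?A" using sub by blast
      let ?u = "\<lambda>x. INF q\<in>C. q x"
      have u: "sublinear ?u" "\<And>r. r \<in> C \<Longrightarrow> ?u \<le> r"
        using sublinear_INF[of C p] False sub chain by blast+
      obtain r where "r \<in> C" using False by blast
      then have "?u \<le> p" using u(2) sub order_trans by blast
      then show ?thesis using u by blast
    qed
  qed
  then obtain m where "m \<in> ?A" and m: "\<And>q. q \<in> ?A \<Longrightarrow> q \<le> m \<Longrightarrow> q = m" by blast
  then show thesis
    by (intro that[of m]) (auto intro: order_trans)
qed

text \<open>A minimal functional equals each of its own shifts, hence is odd and linear. It is
  chosen below the shift of \<open>p\<close> at \<open>z\<close>, not merely below \<open>p\<close>,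
  since this forces \<open>m (- z) \<le> - p z\<close> and hence \<open>m z = p z\<close>.\<close>

lemma hahn_banach_sublinear:
  assumes p: "sublinear p"
  obtains m where "linear m" "m \<le> p" "m z = p z"
proof -
  have shift_le: "sublinear_shift q y \<le> q" if "sublinear q" for q :: "'a \<Rightarrow> real" and y
    using sublinear_shift_le[OF that, of 0 y] by (simp add: le_fun_def)
  obtain m where m: "sublinear m" "m \<le> sublinear_shift p z"
    and min: "\<And>q. sublinear q \<Longrightarrow> q \<le> m \<Longrightarrow> q = m"
    using minimal_sublinear_exists[OF sublinear_shift[OF p]] by blast
  have m_uminus: "m (- x) = - m x" for x
  proof (rule antisym)
    have "sublinear_shift m x = m"
      using min sublinear_shift m(1) shift_le by blast
    then show "m (- x) \<le> - m x" using sublinear_shift_uminus[OF m(1), of x] by simp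
    show "- m x \<le> m (- x)" using sublinear_minus[OF m(1), of x] by simp
  qed
  have "linear m"
  proof (rule linearI)
    fix x y
    have "m (- x + - y) \<le> m (- x) + m (- y)" by (rule sublinear_add[OF m(1)])
    then have "m x + m y \<le> m (x + y)" using m_uminus[of "x + y"] by (simp add: m_uminus)
    then show "m (x + y) = m x + m y" using sublinear_add[OF m(1), of x y] by simp
  next
    fix c x
    show "m (c *\<^sub>R x) = c *\<^sub>R m x"
    proof (cases "c \<ge> 0")
      case False
      then have "m (- ((- c) *\<^sub>R x)) = - (- c * m x)"
        using sublinear_scaleR[OF m(1), of "- c" x] m_uminus by simp
      then show ?thesis by simp
    qed (simp add: sublinear_scaleR[OF m(1)])
  qed
  moreover have "m \<le> p" using m(2) shift_le[OF p] order_trans by blast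
  moreover have "m (- z) \<le> - p z"
    using le_funD[OF m(2), of "- z"] sublinear_shift_uminus[OF p, of z] by simp
  then have "m z = p z" using le_funD[OF \<open>m \<le> p\<close>, of z] by (simp add: m_uminus)
  ultimately show thesis by (rule that)
qed

text \<open>The distance to \<open>V\<close> is sublinear, vanishes on \<open>V\<close>, is at most
  the norm and is nonzero at \<open>z\<close>. A linear functional below it and equal to it at
  \<open>z\<close> is therefore bounded, and it is zero on \<open>V\<close> because both
  \<open>v\<close> and \<open>- v\<close> have distance zero.\<close>

lemma separating_functional:
  fixes V :: "'v::real_normed_vector set"
  assumes V: "subspace V" "closed V" and z: "z \<notin> V"
  obtains \<phi> :: "'v \<Rightarrow>\<^sub>L real" where "\<And>v. v \<in> V \<Longrightarrow> blinfun_apply \<phi> v = 0" "blinfun_apply \<phi> z \<noteq> 0"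
proof -
  have ne: "V \<noteq> {}" using V(1) subspace_0 by blast
  let ?p = "\<lambda>x. infdist x V"
  have le: "?p x \<le> norm (x - v)" if "v \<in> V" for x v
    using infdist_le[OF that] by (simp add: dist_norm)
  have greatest: "m \<le> ?p x" if "\<And>v. v \<in> V \<Longrightarrow> m \<le> norm (x - v)" for m x
    using that ne by (auto simp: infdist_def dist_norm intro!: cINF_greatest)
  have "sublinear ?p"
    unfolding sublinear_def
  proof (intro conjI allI impI)
    fix x y
    have *: "?p (x + y) - norm (x - v) \<le> norm (y - w)" if "v \<in> V" "w \<in> V" for v w
      using le[of "v + w" "x + y"] subspace_add[OF V(1) that]
        norm_triangle_ineq[of "x - v" "y - w"] by (simp add: algebra_simps)
    have "?p (x + y) - ?p y \<le> norm (x - v)" if "v \<in> V" for v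
      using greatest[OF *[OF that]] by simp
    from greatest[OF this] show "?p (x + y) \<le> ?p x + ?p y" by simp
  next
    fix c :: real and x
    assume c: "c > 0"
    have "?p (c *\<^sub>R x) / c \<le> norm (x - v)" if "v \<in> V" for v
    proof -
      have "?p (c *\<^sub>R x) \<le> norm (c *\<^sub>R (x - v))"
        using le[of "c *\<^sub>R v" "c *\<^sub>R x"] subspace_scale[OF V(1) that] by (simp flip: scaleR_diff_right del: norm_scaleR)
      also have "\<dots> = c * norm (x - v)" using c by simp
      finally show ?thesis using c by (simp add: field_simps)
    qed
    from greatest[OF this] show "?p (c *\<^sub>R x) \<le> c * ?p x" using c by (simp add: field_simps)
  qed
  then obtain m where m: "linear m" "m \<le> ?p" "m z = ?p z"
    using hahn_banach_sublinear by blast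
  have m_le: "m x \<le> ?p x" for x using m(2) by (simp add: le_fun_def)
  have m_abs: "\<bar>m x\<bar> \<le> norm x" for x
    using m_le[of x] m_le[of "- x"] le[OF subspace_0[OF V(1)], of x]
      le[OF subspace_0[OF V(1)], of "- x"] linear_neg[OF m(1), of x] by simp
  have "bounded_linear m"
    using m(1) m_abs by (intro bounded_linear_intro[where K = 1]) (auto simp: linear_add linear_scale)
  then have app: "blinfun_apply (Blinfun m) = m" by (rule bounded_linear_Blinfun_apply)
  show thesis
  proof (rule that[of "Blinfun m"])
    fix v assume v: "v \<in> V"
    then have "m v \<le> 0" "m (- v) \<le> 0"
      using m_le[of v] m_le[of "- v"] subspace_neg[OF V(1)] by auto
    then show "blinfun_apply (Blinfun m) v = 0" by (simp add: app linear_neg[OF m(1)])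
  next
    have "?p z \<noteq> 0" using in_closed_iff_infdist_zero[OF V(2) ne] z by blast
    then show "blinfun_apply (Blinfun m) z \<noteq> 0" by (simp add: app m(3))
  qed
qed

subsection \<open>Extension from dense subspaces\<close>

lemma continuous_eq_on_dense:
  fixes f g :: "'a::topological_space \<Rightarrow> 'b::t2_space"
  assumes "continuous_on UNIV f" "continuous_on UNIV g"
    and "closure X = UNIV" and "\<And>x. x \<in> X \<Longrightarrow> f x = g x"
  shows "f x = g x"
proof -
  have "closure X \<subseteq> {x. f x = g x}"
    by (rule closure_minimal) (use assms in \<open>auto intro: closed_Collect_eq\<close>)
  then show ?thesis using assms(3) by blast
qed

text \<open>Linearity and the bound make \<open>f\<close> Lipschitz on \<open>X\<close>, so it
  extends continuously to the closure; the linear identities and the bound pass to the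
  limit.\<close>

lemma bounded_linear_extension:
  fixes f :: "'a::real_normed_vector \<Rightarrow> 'b::banach"
  assumes X: "subspace X" "closure X = UNIV"
    and add: "\<And>x y. x \<in> X \<Longrightarrow> y \<in> X \<Longrightarrow> f (x + y) = f x + f y"
    and scale: "\<And>c x. x \<in> X \<Longrightarrow> f (c *\<^sub>R x) = c *\<^sub>R f x"
    and bound: "\<And>x. x \<in> X \<Longrightarrow> norm (f x) \<le> C * norm x"
  obtains Q :: "'a \<Rightarrow>\<^sub>L 'b" where "\<And>x. x \<in> X \<Longrightarrow> blinfun_apply Q x = f x"
proof -
  \<comment> \<open>\<open>C\<close> may be negative, whereas a Lipschitz constant may not, hence
    \<open>max C 0\<close>.\<close>
  have "dist (f x) (f y) \<le> max C 0 * dist x y" if "x \<in> X" "y \<in> X" for x y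
  proof -
    have "f (x - y) = f x - f y"
      using add[of x "- 1 *\<^sub>R y"] scale[of y "-1"] that subspace_scale[OF X(1), of y "-1"] by simp
    then have "dist (f x) (f y) \<le> C * dist x y"
      using bound[OF subspace_diff[OF X(1) that]] by (simp add: dist_norm)
    also have "\<dots> \<le> max C 0 * dist x y" by (intro mult_right_mono) auto
    finally show ?thesis .
  qed
  then have "(max C 0)-lipschitz_on X f"
    by (intro lipschitz_onI) auto
  then have "uniformly_continuous_on X f"
    by (rule lipschitz_on_uniformly_continuous)
  then obtain g where g: "uniformly_continuous_on (closure X) g" "\<And>x. x \<in> X \<Longrightarrow> f x = g x"
    using uniformly_continuous_on_extension_on_closure by metis
  then have cont: "continuous_on UNIV g"
    using X(2) uniformly_continuous_imp_continuous by metis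
  have cont': "continuous_on UNIV (\<lambda>x. g (h x))" if "continuous_on UNIV h" for h :: "'c::topological_space \<Rightarrow> 'a"
    using continuous_on_compose2[OF cont that] by simp
  have "bounded_linear g"
  proof
    \<comment> \<open>Additivity is an identity in two variables, so it is extended from the dense
      subset \<open>X \<times> X\<close> of the product.\<close>
    have XX: "closure (X \<times> X) = UNIV" by (simp add: closure_Times X(2))
    have "g (fst w + snd w) = g (fst w) + g (snd w)" for w
      by (rule continuous_eq_on_dense[OF _ _ XX])
        (auto intro!: continuous_intros cont' simp: g(2)[symmetric] add subspace_add[OF X(1)])
    from this[of "(x, y)" for x y] show "g (x + y) = g x + g y" for x y by simp
    show "g (c *\<^sub>R x) = c *\<^sub>R g x" for c x
      by (rule continuous_eq_on_dense[OF _ _ X(2)])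
        (auto intro!: continuous_intros cont' simp: g(2)[symmetric] scale subspace_scale[OF X(1)])
    have "closure X \<subseteq> {x. norm (g x) \<le> C * norm x}"
      by (rule closure_minimal)
        (auto intro!: closed_Collect_le continuous_intros cont' simp: g(2)[symmetric] bound)
    then show "\<exists>K. \<forall>x. norm (g x) \<le> norm x * K"
      unfolding X(2) by (intro exI[of _ C]) (auto simp: mult.commute)
  qed
  then have "blinfun_apply (Blinfun g) = g" by (rule bounded_linear_Blinfun_apply)
  then show thesis using g(2) that[of "Blinfun g"] by simp
qed

subsection \<open>Limits in operator topologies\<close>

text \<open>Eventual membership is preserved by finite intersections and arbitrary unions, so
  subbasic sets suffice. The condition on \<open>\<Union>\<S>\<close> places the limit in the
  underlying space of the topology.\<close>

lemma limitin_topology_generated_by: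
  "limitin (topology_generated_by \<S>) f l F \<longleftrightarrow>
    l \<in> \<Union>\<S> \<and> (\<forall>U\<in>\<S>. l \<in> U \<longrightarrow> (\<forall>\<^sub>F x in F. f x \<in> U))" (is "?L \<longleftrightarrow> ?R")
proof
  assume ?L
  then show ?R
    by (auto simp: limitin_def topology_generated_by_Basis)
next
  assume R: ?R
  have "\<forall>\<^sub>F x in F. f x \<in> U" if "generate_topology_on \<S> U" "l \<in> U" for U
    using that
  proof (induction rule: generate_topology_on.induct)
    case (Int a b)
    then show ?case by (auto elim: eventually_elim2)
  next
    case (UN K)
    then obtain k where "k \<in> K" "\<forall>\<^sub>F x in F. f x \<in> k" by blast
    then show ?case by (auto elim: eventually_mono)
  qed (use R in auto)
  then show ?L
    using R by (auto simp: limitin_def openin_topology_generated_by_iff)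
qed

text \<open>The subbasic sets are strips with arbitrary centres \<open>v0\<close>. Strips centred at
  \<open>Q\<close> give pointwise convergence; conversely, a strip around any \<open>v0\<close> that
  contains \<open>Q\<close> is an open condition on one pairing.\<close>

lemma limitin_weak_star_operator_topology:
  fixes R :: "'i \<Rightarrow> ('a::real_normed_vector \<Rightarrow>\<^sub>L 'b::real_normed_vector dual)"
  shows "limitin weak_star_operator_topology R Q F \<longleftrightarrow>
    (\<forall>x y. ((\<lambda>i. blinfun_apply (blinfun_apply (R i) x) y) \<longlongrightarrow> blinfun_apply (blinfun_apply Q x) y) F)"
    (is "?L \<longleftrightarrow> (\<forall>x y. ?lim x y)")
proof -
  let ?v = "\<lambda>R x y. blinfun_apply (blinfun_apply R x) y"
  let ?S = "{{v. p (v - v0) < \<epsilon>} | p (v0 :: 'a \<Rightarrow>\<^sub>L 'b dual) (\<epsilon>::real).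
      p \<in> range (\<lambda>(x, y). \<lambda>R. \<bar>?v R x y\<bar>) \<and> \<epsilon> > 0}"
  have S_iff: "U \<in> ?S \<longleftrightarrow> (\<exists>x y v0 \<epsilon>. U = {v. \<bar>?v v x y - ?v v0 x y\<bar> < \<epsilon>} \<and> \<epsilon> > 0)" for U
  proof
    assume "U \<in> ?S"
    then obtain p v0 \<epsilon> where U: "U = {v. p (v - v0) < \<epsilon>}" "\<epsilon> > 0"
      and "p \<in> range (\<lambda>(x, y). \<lambda>R. \<bar>?v R x y\<bar>)" by blast
    then obtain x y where "p = (\<lambda>R. \<bar>?v R x y\<bar>)" by auto
    then have "U = {v. \<bar>?v v x y - ?v v0 x y\<bar> < \<epsilon>}"
      using U(1) by (simp add: blinfun.diff_left)
    then show "\<exists>x y v0 \<epsilon>. U = {v. \<bar>?v v x y - ?v v0 x y\<bar> < \<epsilon>} \<and> \<epsilon> > 0"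
      using U(2) by blast
  next
    assume "\<exists>x y v0 \<epsilon>. U = {v. \<bar>?v v x y - ?v v0 x y\<bar> < \<epsilon>} \<and> \<epsilon> > 0"
    then obtain x y v0 \<epsilon> where U: "U = {v. \<bar>?v v x y - ?v v0 x y\<bar> < \<epsilon>}" "\<epsilon> > 0" by blast
    show "U \<in> ?S"
      unfolding U(1)
      by (intro CollectI exI[of _ "\<lambda>R. \<bar>?v R x y\<bar>"] exI[of _ v0] exI[of _ \<epsilon>] conjI U(2)
          image_eqI[of _ _ "(x, y)"])
        (simp_all add: blinfun.diff_left)
  qed
  have L_iff: "?L \<longleftrightarrow> Q \<in> \<Union>?S \<and> (\<forall>U\<in>?S. Q \<in> U \<longrightarrow> (\<forall>\<^sub>F i in F. R i \<in> U))"
    unfolding weak_star_operator_topology_def seminorm_topology_def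
    by (rule limitin_topology_generated_by)
  show ?thesis
  proof
    assume L: ?L
    show "\<forall>x y. ?lim x y"
    proof (intro allI tendstoI)
      fix x y and \<epsilon> :: real
      assume "\<epsilon> > 0"
      let ?U = "{v. \<bar>?v v x y - ?v Q x y\<bar> < \<epsilon>}"
      have "?U \<in> ?S" unfolding S_iff using \<open>\<epsilon> > 0\<close> by blast
      moreover have "Q \<in> ?U" using \<open>\<epsilon> > 0\<close> by simp
      ultimately have "\<forall>\<^sub>F i in F. R i \<in> ?U"
        by (rule mp[OF bspec[OF conjunct2[OF iffD1[OF L_iff L]]]])
      then show "\<forall>\<^sub>F i in F. dist (?v (R i) x y) (?v Q x y) < \<epsilon>" by (simp add: dist_real_def)
    qed
  next
    assume lim: "\<forall>x y. ?lim x y"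
    \<comment> \<open>At \<open>x = y = 0\<close> the strip is the whole space, which shows that
      \<open>Q\<close> lies in the underlying set.\<close>
    have "{v. \<bar>?v v 0 0 - ?v Q 0 0\<bar> < 1} \<in> ?S" unfolding S_iff using zero_less_one by blast
    then have "Q \<in> \<Union>?S" by (rule UnionI) simp
    moreover have "\<forall>\<^sub>F i in F. R i \<in> U" if U: "U \<in> ?S" "Q \<in> U" for U
    proof -
      obtain x y v0 \<epsilon> where U_eq: "U = {v. \<bar>?v v x y - ?v v0 x y\<bar> < \<epsilon>}"
        using U(1) unfolding S_iff by blast
      have "((\<lambda>i. \<bar>?v (R i) x y - ?v v0 x y\<bar>) \<longlongrightarrow> \<bar>?v Q x y - ?v v0 x y\<bar>) F"
        by (intro tendsto_rabs tendsto_diff tendsto_const lim[rule_format])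
      moreover have "\<bar>?v Q x y - ?v v0 x y\<bar> < \<epsilon>" using U(2) U_eq by simp
      ultimately have "\<forall>\<^sub>F i in F. \<bar>?v (R i) x y - ?v v0 x y\<bar> < \<epsilon>" by (rule order_tendstoD)
      then show ?thesis by (simp add: U_eq)
    qed
    ultimately show ?L unfolding L_iff by blast
  qed
qed

text \<open>The topology is the pullback of the product topology under \<open>blinfun_apply\<close>,
  and limits in a product are componentwise.\<close>

lemma limitin_strong_operator_topology:
  "limitin strong_operator_topology R Q F \<longleftrightarrow>
    (\<forall>x. ((\<lambda>i. blinfun_apply (R i) x) \<longlongrightarrow> blinfun_apply Q x) F)" (is "?L \<longleftrightarrow> ?R")
proof -
  have "?L \<longleftrightarrow> limitin euclidean (\<lambda>i. blinfun_apply (R i)) (blinfun_apply Q) F"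
  proof -
    have open_iff: "openin strong_operator_topology U \<longleftrightarrow> (\<exists>V. open V \<and> U = blinfun_apply -` V)" for U :: "('a \<Rightarrow>\<^sub>L 'b) set"
      by (simp add: strong_operator_topology_def openin_pullback_topology)
    show ?thesis
      by (auto simp: limitin_def strong_operator_topology_topspace open_iff)
  qed
  also have "\<dots> \<longleftrightarrow> ?R"
    unfolding euclidean_product_topology[symmetric] limitin_componentwise by simp
  finally show ?thesis .
qed

text \<open>Uniqueness of limits makes the description operator meaningful. Keeping it as a
  hypothesis lets the lemma serve the norm, weak-star and strong operator topologies.\<close>

lemma generator_wrt_eq_Some_iff:
  assumes unique: "\<And>f l l'. limitin \<tau> f l (at_right (0::real)) \<Longrightarrow> limitin \<tau> f l' (at_right 0) \<Longrightarrow> l = l'"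
  shows "generator_wrt \<tau> U v = Some w \<longleftrightarrow>
    limitin \<tau> (\<lambda>t. (1 / t) *\<^sub>R (U t v - v)) w (at_right 0)" (is "_ \<longleftrightarrow> ?lim w")
proof -
  have "(THE w. ?lim w) = w" if "?lim w" for w
    using that unique by (intro the_equality) auto
  then show ?thesis unfolding generator_wrt_def by (auto simp del: limitin_canonical_iff)
qed

lemma generator_eq_Some_iff:
  "generator T x = Some w \<longleftrightarrow> ((\<lambda>t. (1 / t) *\<^sub>R (blinfun_apply (T t) x - x)) \<longlongrightarrow> w) (at_right 0)"
  unfolding generator_def
  by (subst generator_wrt_eq_Some_iff) (auto intro: tendsto_unique[rotated])

subsection \<open>\<open>C\<^sub>0\<close> semigroups on a short time interval\<close>

lemma eventually_at_withinI: "(\<And>s. s \<in> S \<Longrightarrow> P s) \<Longrightarrow> eventually P (at t within S)"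
  by (simp add: eventually_at_filter)

text \<open>Links derivatives with the quotients that define generators: for
  \<open>s \<noteq> a\<close>, the normalised remainder and the error of the quotient have the same
  norm.\<close>

lemma has_vector_derivative_iff_quotient:
  fixes f :: "real \<Rightarrow> 'a::real_normed_vector"
  shows "(f has_vector_derivative d) (at a within S) \<longleftrightarrow>
    ((\<lambda>s. (1 / (s - a)) *\<^sub>R (f s - f a)) \<longlongrightarrow> d) (at a within S)"
proof -
  have eq: "norm (((f s - f a) - (s - a) *\<^sub>R d) /\<^sub>R norm (s - a)) =
      norm ((1 / (s - a)) *\<^sub>R (f s - f a) - d)" if "s \<noteq> a" for s
  proof -
    have "(1 / (s - a)) *\<^sub>R (f s - f a) - d = (1 / (s - a)) *\<^sub>R ((f s - f a) - (s - a) *\<^sub>R d)"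
      using that by (simp add: scaleR_diff_right)
    then show ?thesis by (simp add: divide_inverse)
  qed
  have "(f has_vector_derivative d) (at a within S) \<longleftrightarrow>
      ((\<lambda>s. norm (((f s - f a) - (s - a) *\<^sub>R d) /\<^sub>R norm (s - a))) \<longlongrightarrow> 0) (at a within S)"
    by (simp add: has_vector_derivative_def has_derivative_at_within bounded_linear_scaleR_left
        tendsto_norm_zero_iff del: norm_scaleR)
  also have "\<dots> \<longleftrightarrow> ((\<lambda>s. norm ((1 / (s - a)) *\<^sub>R (f s - f a) - d)) \<longlongrightarrow> 0) (at a within S)"
    by (rule tendsto_cong) (use eq in \<open>auto simp: eventually_at_filter\<close>)
  also have "\<dots> \<longleftrightarrow> ((\<lambda>s. (1 / (s - a)) *\<^sub>R (f s - f a)) \<longlongrightarrow> d) (at a within S)"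
    by (simp add: tendsto_norm_zero_iff Lim_null[symmetric] del: norm_scaleR)
  finally show ?thesis .
qed

lemma has_vector_derivative_right_quotient:
  fixes f :: "real \<Rightarrow> 'a::real_normed_vector"
  assumes "(f has_vector_derivative d) (at a within {c..b})" and "c \<le> a" "a < b"
  shows "((\<lambda>k. (1 / k) *\<^sub>R (f (a + k) - f a)) \<longlongrightarrow> d) (at_right 0)"
proof -
  have "(f has_vector_derivative d) (at a within {a..b})"
    by (rule has_vector_derivative_within_subset[OF assms(1)]) (use assms(2) in auto)
  then have "((\<lambda>s. (1 / (s - a)) *\<^sub>R (f s - f a)) \<longlongrightarrow> d) (at_right a)"
    unfolding has_vector_derivative_iff_quotient at_within_Icc_at_right[OF assms(3)] .
  then show ?thesis
    unfolding filterlim_at_right_to_0[of _ _ a] by (simp add: add.commute)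
qed

text \<open>Otherwise there are times \<open>t n\<close> tending to \<open>0\<close> with
  \<open>norm (T (t n)) > n\<close>. Each orbit converges along these times and is thus bounded,
  contradicting uniform boundedness.\<close>

lemma C0_semigroup_bounded:
  fixes T :: "real \<Rightarrow> ('a::banach \<Rightarrow>\<^sub>L 'a)"
  assumes T: "C0_semigroup T"
  obtains \<delta> M where "\<delta> > 0" "\<And>t. 0 \<le> t \<Longrightarrow> t \<le> \<delta> \<Longrightarrow> norm (T t) \<le> M"
proof -
  have "\<exists>n. \<forall>t\<in>{0..1 / real (Suc n)}. norm (T t) \<le> real n"
  proof (rule ccontr)
    assume "\<not> ?thesis"
    then have "\<forall>n. \<exists>t. 0 \<le> t \<and> t \<le> 1 / real (Suc n) \<and> norm (T t) > real n"
      by (metis atLeastAtMost_iff not_le)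
    then obtain t where t: "\<And>n. 0 \<le> t n" "\<And>n. t n \<le> 1 / real (Suc n)"
      and large: "\<And>n. norm (T (t n)) > real n" by metis
    have "t \<longlonglongrightarrow> 0"
    proof (rule tendsto_sandwich[of "\<lambda>_. 0" _ _ "\<lambda>n. 1 / real (Suc n)"])
      show "(\<lambda>n. 1 / real (Suc n)) \<longlonglongrightarrow> 0" by (rule LIMSEQ_Suc[OF lim_1_over_n])
    qed (use t in auto)
    have "\<exists>C. \<forall>f\<in>range (\<lambda>n. T (t n)). norm (blinfun_apply f x) \<le> C" for x
    proof -
      \<comment> \<open>Some \<open>t n\<close> may be \<open>0\<close>, so the right-hand limit is
        first turned into continuity at \<open>0\<close> within \<open>{0..}\<close>.\<close>
      have "at 0 within {0..} = (at_right 0 :: real filter)"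
        using at_within_Ici_at_right by blast
      then have "continuous (at 0 within {0..}) (\<lambda>s. blinfun_apply (T s) x)"
        using T by (simp add: continuous_within C0_semigroup_def)
      then have "(\<lambda>n. blinfun_apply (T (t n)) x) \<longlonglongrightarrow> blinfun_apply (T 0) x"
        using \<open>t \<longlonglongrightarrow> 0\<close> t(1) unfolding continuous_within_sequentially by (auto simp: comp_def)
      then obtain C where "\<And>n. norm (blinfun_apply (T (t n)) x) \<le> C"
        using convergentI convergent_imp_Bseq BseqE by metis
      then show ?thesis by auto
    qed
    then obtain C where C: "\<And>n. norm (T (t n)) \<le> C"
      using uniform_boundedness[of "range (\<lambda>n. T (t n))"] by auto
    obtain n :: nat where "C \<le> real n" using real_arch_simple by blast
    with C[of n] large[of n] show False by simp
  qed
  then obtain n where "\<And>t. t \<in> {0..1 / real (Suc n)} \<Longrightarrow> norm (T t) \<le> real n" by blast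
  then show thesis by (intro that[of "1 / real (Suc n)" "real n"]) auto
qed

text \<open>A generator is a limit at \<open>0\<close> from the right, so a uniform bound on one
  short interval replaces a global growth bound.\<close>

locale local_semigroup =
  fixes T :: "real \<Rightarrow> ('a::banach \<Rightarrow>\<^sub>L 'a)" and \<delta> M :: real
  assumes C0: "C0_semigroup T"
    and delta_pos: "\<delta> > 0"
    and bounded: "0 \<le> t \<Longrightarrow> t \<le> \<delta> \<Longrightarrow> norm (T t) \<le> M"
begin

section \<open>Continuity and differentiability of orbits\<close>

lemma zero [simp]: "T 0 = id_blinfun"
  using C0 by (simp add: C0_semigroup_def)

lemma add: "0 \<le> s \<Longrightarrow> 0 \<le> t \<Longrightarrow> blinfun_apply (T (s + t)) x = blinfun_apply (T s) (blinfun_apply (T t) x)"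
  using C0 by (simp add: C0_semigroup_def)

lemma tendsto_zero: "((\<lambda>t. blinfun_apply (T t) x) \<longlongrightarrow> x) (at_right 0)"
  using C0 by (simp add: C0_semigroup_def)

lemma M_nonneg: "0 \<le> M"
  using bounded[of 0] delta_pos by (auto intro: order_trans[OF norm_ge_zero])

lemma apply_le: "0 \<le> t \<Longrightarrow> t \<le> \<delta> \<Longrightarrow> norm (blinfun_apply (T t) x) \<le> M * norm x"
  by (rule order_trans[OF norm_blinfun mult_right_mono[OF bounded]]) auto

text \<open>Factoring out the operator at the smaller time reduces left and right increments alike
  to an increment at \<open>0\<close>, so that two-sided continuity and derivatives follow from
  right limits at \<open>0\<close>.\<close>

lemma diff_eq:
  assumes "0 \<le> s" "0 \<le> t"
  shows "blinfun_apply (T s) x - blinfun_apply (T t) x =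
    sgn (s - t) *\<^sub>R blinfun_apply (T (min s t)) (blinfun_apply (T \<bar>s - t\<bar>) x - x)"
  using add[of t "s - t" x] add[of s "t - s" x] assms
  by (cases s t rule: linorder_cases) (auto simp: blinfun.diff_right)

lemma filterlim_abs_diff: "filterlim (\<lambda>s. \<bar>s - t\<bar>) (at_right 0) (at t within S)" for t :: real
proof -
  have "((\<lambda>s. \<bar>s - t\<bar>) \<longlongrightarrow> \<bar>t - t\<bar>) (at t within S)" by (intro tendsto_intros)
  then show ?thesis by (auto simp: filterlim_at eventually_at_filter)
qed

lemma min_bounds: "0 \<le> s \<Longrightarrow> s \<le> \<delta> \<Longrightarrow> 0 \<le> t \<Longrightarrow> 0 \<le> min s t \<and> min s t \<le> \<delta>"
  by (auto simp: min_def)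

lemma continuous: "continuous_on {0..\<delta>} (\<lambda>t. blinfun_apply (T t) x)"
  unfolding continuous_on
proof
  fix t assume t: "t \<in> {0..\<delta>}"
  have "norm (blinfun_apply (T s) x - blinfun_apply (T t) x) \<le> norm (blinfun_apply (T \<bar>s - t\<bar>) x - x) * M"
    if "s \<in> {0..\<delta>}" for s
    using that t min_bounds[of s t] apply_le[of "min s t"]
    by (cases "s = t") (auto simp: diff_eq sgn_if mult.commute M_nonneg)
  moreover have "((\<lambda>s. norm (blinfun_apply (T \<bar>s - t\<bar>) x - x) * M) \<longlongrightarrow> 0) (at t within {0..\<delta>})"
    by (intro tendsto_mult_left_zero tendsto_norm_zero LIM_zero
        filterlim_compose[OF tendsto_zero filterlim_abs_diff])
  ultimately have "((\<lambda>s. blinfun_apply (T s) x - blinfun_apply (T t) x) \<longlongrightarrow> 0) (at t within {0..\<delta>})"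
    by (rule Lim_null_comparison[OF eventually_at_withinI])
  then show "((\<lambda>s. blinfun_apply (T s) x) \<longlongrightarrow> blinfun_apply (T t) x) (at t within {0..\<delta>})"
    by (rule LIM_zero_cancel)
qed

text \<open>The operator left over by \<open>diff_eq\<close> varies with \<open>s\<close> when
  \<open>s < t\<close>. The bound \<open>M\<close> controls the error of \<open>z s\<close>, and
  continuity of the orbit of \<open>w\<close> controls the rest.\<close>

lemma tendsto_apply_min:
  assumes t: "t \<in> {0..\<delta>}" and z: "(z \<longlongrightarrow> w) (at t within {0..\<delta>})"
  shows "((\<lambda>s. blinfun_apply (T (min s t)) (z s)) \<longlongrightarrow> blinfun_apply (T t) w) (at t within {0..\<delta>})"
proof -
  let ?b = "\<lambda>s. M * norm (z s - w) + norm (blinfun_apply (T s) w - blinfun_apply (T t) w)"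
  have "norm (blinfun_apply (T (min s t)) (z s) - blinfun_apply (T t) w) \<le> ?b s"
    if "s \<in> {0..\<delta>}" for s
  proof -
    have "blinfun_apply (T (min s t)) (z s) - blinfun_apply (T t) w =
        blinfun_apply (T (min s t)) (z s - w) + (blinfun_apply (T (min s t)) w - blinfun_apply (T t) w)"
      by (simp add: blinfun.diff_right)
    also have "norm \<dots> \<le> M * norm (z s - w) + norm (blinfun_apply (T (min s t)) w - blinfun_apply (T t) w)"
      using that t min_bounds[of s t] by (intro norm_triangle_mono apply_le) auto
    \<comment> \<open>If the minimum is \<open>t\<close>, the second difference vanishes; if it is
      \<open>s\<close>, it is the one in \<open>?b\<close>.\<close>
    also have "\<dots> \<le> ?b s" by (auto simp: min_def)
    finally show ?thesis .
  qed
  moreover have "(?b \<longlongrightarrow> 0) (at t within {0..\<delta>})"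
    using continuous[of w] t z
    by (intro tendsto_add_zero tendsto_mult_right_zero tendsto_norm_zero LIM_zero) (auto simp: continuous_on)
  ultimately have "((\<lambda>s. blinfun_apply (T (min s t)) (z s) - blinfun_apply (T t) w) \<longlongrightarrow> 0) (at t within {0..\<delta>})"
    by (rule Lim_null_comparison[OF eventually_at_withinI])
  then show ?thesis by (rule LIM_zero_cancel)
qed

text \<open>By \<open>diff_eq\<close>, the quotient between \<open>s\<close> and \<open>t\<close> is
  \<open>T (min s t)\<close> applied to the quotient at \<open>0\<close> with step
  \<open>\<bar>s - t\<bar>\<close>; the signs cancel.\<close>

lemma generator_has_vector_derivative:
  assumes w: "generator T x = Some w" and t: "t \<in> {0..\<delta>}"
  shows "((\<lambda>s. blinfun_apply (T s) x) has_vector_derivative blinfun_apply (T t) w) (at t within {0..\<delta>})"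
proof -
  let ?z = "\<lambda>s. (1 / \<bar>s - t\<bar>) *\<^sub>R (blinfun_apply (T \<bar>s - t\<bar>) x - x)"
  have "(?z \<longlongrightarrow> w) (at t within {0..\<delta>})"
    using w unfolding generator_eq_Some_iff by (rule filterlim_compose[OF _ filterlim_abs_diff])
  then have "((\<lambda>s. blinfun_apply (T (min s t)) (?z s)) \<longlongrightarrow> blinfun_apply (T t) w) (at t within {0..\<delta>})"
    by (rule tendsto_apply_min[OF t])
  moreover have "(1 / (s - t)) *\<^sub>R (blinfun_apply (T s) x - blinfun_apply (T t) x) =
      blinfun_apply (T (min s t)) (?z s)" if "s \<in> {0..\<delta>}" for s
    using that t by (cases s t rule: linorder_cases) (auto simp: diff_eq blinfun.scaleR_right minus_divide_right simp flip: scaleR_minus_left)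
  ultimately show ?thesis
    unfolding has_vector_derivative_iff_quotient
    by (elim Lim_transform_eventually[OF _ eventually_at_withinI]) simp
qed

text \<open>\<open>T t\<close> is continuous and commutes with \<open>T h\<close>, so it can be
  applied to the quotients that define \<open>w\<close>.\<close>

lemma generator_invariant:
  assumes w: "generator T x = Some w" and t: "0 \<le> t"
  shows "generator T (blinfun_apply (T t) x) = Some (blinfun_apply (T t) w)"
  unfolding generator_eq_Some_iff
proof (rule Lim_transform_eventually)
  show "((\<lambda>h. blinfun_apply (T t) ((1 / h) *\<^sub>R (blinfun_apply (T h) x - x))) \<longlongrightarrow> blinfun_apply (T t) w) (at_right 0)"
    using w unfolding generator_eq_Some_iff by (rule blinfun.tendsto[OF tendsto_const])
  have "blinfun_apply (T h) (blinfun_apply (T t) x) = blinfun_apply (T t) (blinfun_apply (T h) x)"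
    if "h > 0" for h
    using add[of h t x] add[of t h x] that t by (simp add: add.commute)
  then show "\<forall>\<^sub>F h in at_right 0. blinfun_apply (T t) ((1 / h) *\<^sub>R (blinfun_apply (T h) x - x)) =
      (1 / h) *\<^sub>R (blinfun_apply (T h) (blinfun_apply (T t) x) - blinfun_apply (T t) x)"
    by (auto simp: eventually_at_filter blinfun.scaleR_right blinfun.diff_right)
qed

section \<open>Orbit integrals and density of the domain\<close>

definition orbit_integral :: "real \<Rightarrow> 'a \<Rightarrow> 'a" where
  "orbit_integral u x = integral {0..u} (\<lambda>s. blinfun_apply (T s) x)"

lemma continuous_sub: "0 \<le> a \<Longrightarrow> b \<le> \<delta> \<Longrightarrow> continuous_on {a..b} (\<lambda>t. blinfun_apply (T t) x)"
  by (rule continuous_on_subset[OF continuous]) auto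

lemma integrable: "0 \<le> a \<Longrightarrow> b \<le> \<delta> \<Longrightarrow> (\<lambda>t. blinfun_apply (T t) x) integrable_on {a..b}"
  by (rule integrable_continuous_real[OF continuous_sub])

lemma orbit_integral_diff:
  assumes "0 \<le> a" "a \<le> b" "b \<le> \<delta>"
  shows "orbit_integral b x - orbit_integral a x = integral {a..b} (\<lambda>s. blinfun_apply (T s) x)"
  using Henstock_Kurzweil_Integration.integral_combine[OF assms(1,2) integrable[of 0 b x]] assms
  by (simp add: orbit_integral_def algebra_simps)

lemma orbit_integral_diff_le:
  assumes "0 \<le> a" "a \<le> b" "b \<le> \<delta>"
  shows "norm (orbit_integral b x - orbit_integral a x) \<le> M * norm x * (b - a)"
  unfolding orbit_integral_diff[OF assms]
  by (intro integral_bound continuous_sub apply_le) (use assms in auto)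

text \<open>\<open>T k\<close> passes under the integral and, by the semigroup law, shifts the
  interval of integration by \<open>k\<close>.\<close>

lemma apply_orbit_integral:
  assumes "0 \<le> k" "0 \<le> h" "h + k \<le> \<delta>"
  shows "blinfun_apply (T k) (orbit_integral h x) = orbit_integral (h + k) x - orbit_integral k x"
proof -
  have "blinfun_apply (T k) (orbit_integral h x) =
      integral {0..h} (blinfun_apply (T k) \<circ> (\<lambda>s. blinfun_apply (T s) x))"
    unfolding orbit_integral_def
    by (rule integral_linear[symmetric]) (use assms integrable in \<open>auto intro: blinfun.bounded_linear_right\<close>)
  also have "\<dots> = integral {0..h} ((\<lambda>s. blinfun_apply (T s) x) \<circ> (+) k)"
    by (rule integral_cong) (use assms in \<open>simp add: add\<close>)
  also have "\<dots> = integral {k..h + k} (\<lambda>s. blinfun_apply (T s) x)"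
    by (simp add: integral_shift_Icc_real)
  finally show ?thesis using assms by (simp add: orbit_integral_diff)
qed

lemma orbit_integral_quotient:
  assumes "0 \<le> h" "h < \<delta>"
  shows "((\<lambda>k. (1 / k) *\<^sub>R (orbit_integral (h + k) x - orbit_integral h x)) \<longlongrightarrow> blinfun_apply (T h) x) (at_right 0)"
  unfolding orbit_integral_def
  by (rule has_vector_derivative_right_quotient[OF integral_has_vector_derivative[OF continuous]])
    (use assms in auto)

text \<open>The increment of the semigroup at the integral is the integral over
  \<open>[h, h + k]\<close> minus that over \<open>[0, k]\<close>. Divided by \<open>k\<close>,
  these tend to the values of the orbit at \<open>h\<close> and \<open>0\<close> by the fundamental
  theorem of calculus.\<close>

lemma orbit_integral_generator:
  assumes h: "0 \<le> h" "h < \<delta>"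
  shows "generator T (orbit_integral h x) = Some (blinfun_apply (T h) x - x)"
  unfolding generator_eq_Some_iff
proof (rule Lim_transform_eventually)
  show "((\<lambda>k. (1 / k) *\<^sub>R (orbit_integral (h + k) x - orbit_integral h x) -
      (1 / k) *\<^sub>R (orbit_integral (0 + k) x - orbit_integral 0 x)) \<longlongrightarrow> blinfun_apply (T h) x - x) (at_right 0)"
    using tendsto_diff[OF orbit_integral_quotient[OF h] orbit_integral_quotient[of 0]] delta_pos
    by simp
  \<comment> \<open>Keeps \<open>h + k\<close> inside the interval on which continuity of orbits is
    known.\<close>
  have "\<forall>\<^sub>F k in at_right 0. k < \<delta> - h"
    by (rule order_tendstoD(2)[OF tendsto_ident_at]) (use h in simp)
  moreover have "\<forall>\<^sub>F k in at_right 0. k > (0::real)"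
    by (simp add: eventually_at_filter)
  ultimately show "\<forall>\<^sub>F k in at_right 0. (1 / k) *\<^sub>R (orbit_integral (h + k) x - orbit_integral h x) -
      (1 / k) *\<^sub>R (orbit_integral (0 + k) x - orbit_integral 0 x) =
      (1 / k) *\<^sub>R (blinfun_apply (T k) (orbit_integral h x) - orbit_integral h x)"
  proof eventually_elim
    case (elim k)
    then have "blinfun_apply (T k) (orbit_integral h x) = orbit_integral (h + k) x - orbit_integral k x"
      using h by (intro apply_orbit_integral) auto
    then show ?case by (simp add: orbit_integral_def scaleR_diff_right)
  qed
qed

lemma average_tendsto: "((\<lambda>h. (1 / h) *\<^sub>R orbit_integral h x) \<longlongrightarrow> x) (at_right 0)"
  using orbit_integral_quotient[of 0 x] delta_pos by (simp add: orbit_integral_def)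

lemma generator_linear:
  assumes "generator T x = Some v" "generator T y = Some w"
  shows "generator T (x + y) = Some (v + w)" "generator T (c *\<^sub>R x) = Some (c *\<^sub>R v)"
  using tendsto_add[OF assms[unfolded generator_eq_Some_iff]]
    tendsto_scaleR[OF tendsto_const[of c] assms(1)[unfolded generator_eq_Some_iff]]
  by (simp_all add: generator_eq_Some_iff blinfun.add_right blinfun.scaleR_right algebra_simps)

lemma subspace_dom: "subspace (dom (generator T))"
proof -
  have "generator T 0 = Some 0" by (simp add: generator_eq_Some_iff)
  then show ?thesis
    unfolding subspace_def dom_def using generator_linear by blast
qed

text \<open>The averages of an orbit over \<open>[0, h]\<close> lie in the domain and tend to its
  starting point.\<close>

lemma dense_dom: "closure (dom (generator T)) = UNIV"
proof -
  have "x \<in> closure (dom (generator T))" for x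
  proof (rule Lim_in_closed_set[OF _ _ _ average_tendsto])
    have "(1 / h) *\<^sub>R orbit_integral h x \<in> dom (generator T)" if "0 < h" "h < \<delta>" for h
      using orbit_integral_generator[of h x] that by (intro subspace_scale[OF subspace_dom]) auto
    then have "\<forall>\<^sub>F h in at_right 0. (1 / h) *\<^sub>R orbit_integral h x \<in> dom (generator T)"
      by (intro eventually_at_rightI[OF _ delta_pos]) simp
    then show "\<forall>\<^sub>F h in at_right 0. (1 / h) *\<^sub>R orbit_integral h x \<in> closure (dom (generator T))"
      by (rule eventually_mono) (rule subsetD[OF closure_subset])
  qed auto
  then show ?thesis by blast
qed

lemma bounded_linear_orbit_integral:
  assumes h: "0 \<le> h" "h \<le> \<delta>"
  shows "bounded_linear (orbit_integral h)"
proof (rule bounded_linear_intro)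
  show "orbit_integral h (x + y) = orbit_integral h x + orbit_integral h y" for x y
    using integrable[of 0 h] h by (simp add: orbit_integral_def blinfun.add_right integral_add)
  show "orbit_integral h (c *\<^sub>R x) = c *\<^sub>R orbit_integral h x" for c x
    by (simp add: orbit_integral_def blinfun.scaleR_right)
  show "norm (orbit_integral h x) \<le> norm x * (M * h)" for x
    using orbit_integral_diff_le[of 0 h x] h by (simp add: orbit_integral_def mult_ac)
qed

end

subsection \<open>Adjoints and closures of unbounded operators\<close>

lemma blinfun_compose_id: "f o\<^sub>L id_blinfun = f"
  by (rule blinfun_eqI) simp

text \<open>A functional is determined by its values on the dense domain of \<open>B\<close>, so the
  description in \<open>adjoint_op\<close> has exactly one candidate.\<close>

lemma adjoint_op_eq_Some_iff:
  assumes dense: "closure (dom B) = UNIV"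
  shows "adjoint_op B f = Some g \<longleftrightarrow>
    (\<forall>y\<in>dom B. blinfun_apply f (the (B y)) = blinfun_apply g y)" (is "_ \<longleftrightarrow> ?adj g")
proof -
  have unique: "g = h" if "?adj g" "?adj h" for g h
  proof (rule blinfun_eqI)
    fix y
    show "blinfun_apply g y = blinfun_apply h y"
      by (rule continuous_eq_on_dense[OF _ _ dense]) (use that in \<open>auto intro!: continuous_intros\<close>)
  qed
  have the_eq: "(THE g. ?adj g) = g" if "?adj g" for g
    by (rule the_equality[where P = ?adj]) (rule that, rule unique[OF _ that])
  show ?thesis
  proof
    assume f: "adjoint_op B f = Some g"
    then obtain h where h: "?adj h" unfolding adjoint_op_def by (meson option.distinct(1))
    then have "(\<exists>g. ?adj g) = True" by blast
    then have "g = h" using f the_eq[OF h] unfolding adjoint_op_def by simp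
    then show "?adj g" using h by simp
  next
    assume g: "?adj g"
    then have "(\<exists>g. ?adj g) = True" by blast
    then show "adjoint_op B f = Some g" unfolding adjoint_op_def the_eq[OF g] by simp
  qed
qed

text \<open>The graph of \<open>Q\<close> is closed, and the part over a dense set is dense in it
  because \<open>x \<mapsto> (x, Q x)\<close> is continuous.\<close>

lemma closure_op_bounded:
  fixes Q :: "'a::real_normed_vector \<Rightarrow>\<^sub>L 'b::real_normed_vector"
  assumes dense: "closure (dom F) = UNIV" and eq: "\<And>x. x \<in> dom F \<Longrightarrow> the (F x) = blinfun_apply Q x"
  shows "closure_op F = (\<lambda>x. Some (blinfun_apply Q x))"
proof -
  let ?g = "\<lambda>x. (x, blinfun_apply Q x)"
  have graph_F: "Map.graph F = ?g ` dom F"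
    using eq by (auto simp: graph_eq_to_snd_dom)
  have graph_Q: "Map.graph (\<lambda>x. Some (blinfun_apply Q x)) = range ?g"
    by (auto simp: Map.graph_def)
  have "closed {z. snd z = blinfun_apply Q (fst z)}"
    by (intro closed_Collect_eq continuous_intros)
  moreover have "{z. snd z = blinfun_apply Q (fst z)} = range ?g" by force
  ultimately have "closed (range ?g)" by simp
  then have "closure (?g ` dom F) \<subseteq> range ?g" by (intro closure_minimal) auto
  moreover have "?g ` closure (dom F) \<subseteq> closure (?g ` dom F)"
    by (intro image_closure_subset closure_subset closed_closure continuous_intros)
  ultimately have closure_graph: "closure (Map.graph F) = Map.graph (\<lambda>x. Some (blinfun_apply Q x))"
    unfolding graph_F graph_Q dense by blast
  \<comment> \<open>A partial map is determined by its graph, which gives the uniqueness that the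
    description in \<open>closure_op\<close> requires.\<close>
  have "G = H" if "Map.graph G = Map.graph H" for G H :: "'a \<rightharpoonup> 'b"
  proof
    fix x
    have "G x = Some v \<longleftrightarrow> H x = Some v" for v
      using that by (metis in_graphD in_graphI)
    then show "G x = H x" by (metis not_Some_eq)
  qed
  then show ?thesis
    unfolding closure_op_def closure_graph by (intro the_equality) auto
qed

subsection \<open>The Lyapunov equation and the implemented semigroup\<close>

locale implemented = T: local_semigroup T \<delta> M + S: local_semigroup S \<delta> M
  for T :: "real \<Rightarrow> ('a::banach \<Rightarrow>\<^sub>L 'a)" and S :: "real \<Rightarrow> ('b::banach \<Rightarrow>\<^sub>L 'b)" and \<delta> M
begin

section \<open>The weak form of the Lyapunov operator\<close>

abbreviation "A \<equiv> generator T"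
abbreviation "B \<equiv> generator S"

text \<open>The identity of part (i). The adjoint of \<open>B\<close> is moved to the other side of
  the pairing, so neither adjoints nor closures occur and both generators can be compared with
  it.\<close>

definition lyapunov_eq :: "('a \<Rightarrow>\<^sub>L 'b dual) \<Rightarrow> ('a \<Rightarrow>\<^sub>L 'b dual) \<Rightarrow> bool" where
  "lyapunov_eq P Q \<longleftrightarrow> (\<forall>x\<in>dom A. \<forall>y\<in>dom B.
     blinfun_apply (blinfun_apply P x) (the (B y)) +
     blinfun_apply (blinfun_apply P (the (A x))) y =
     blinfun_apply (blinfun_apply Q x) y)"

text \<open>For \<open>x \<in> dom A\<close> the identity says that the adjoint of \<open>B\<close>
  is defined at \<open>P x\<close> with value \<open>Q x - P (A x)\<close>. So
  \<open>lyapunov_op A B P\<close> is the restriction of \<open>Q\<close> to a dense domain, and its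
  closure is \<open>Q\<close>.\<close>

lemma lyapunov_generator_eq_Some:
  assumes PQ: "lyapunov_eq P Q"
  shows "lyapunov_generator A B P = Some Q"
proof -
  have adj: "adjoint_op B (blinfun_apply P x) = Some (blinfun_apply Q x - blinfun_apply P (the (A x)))"
    if "x \<in> dom A" for x
    unfolding adjoint_op_eq_Some_iff[OF S.dense_dom]
  proof
    fix y assume "y \<in> dom B"
    then show "blinfun_apply (blinfun_apply P x) (the (B y)) =
        blinfun_apply (blinfun_apply Q x - blinfun_apply P (the (A x))) y"
      using PQ that unfolding lyapunov_eq_def blinfun.diff_left by (simp add: eq_diff_eq)
  qed
  then have op: "lyapunov_op A B P x = (if x \<in> dom A then Some (blinfun_apply Q x) else None)" for x
    by (auto simp: lyapunov_op_def)
  then have dom_op: "dom (lyapunov_op A B P) = dom A"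
    by (auto split: if_splits)
  have "closure_op (lyapunov_op A B P) = (\<lambda>x. Some (blinfun_apply Q x))"
    by (rule closure_op_bounded) (simp_all add: dom_op T.dense_dom op)
  moreover have "bounded_op (lyapunov_op A B P)"
    unfolding bounded_op_def dom_op by (intro exI[of _ "norm Q"]) (auto simp: op norm_blinfun)
  moreover have "(THE Q'. (\<lambda>x. Some (blinfun_apply Q' x)) = (\<lambda>x. Some (blinfun_apply Q x))) = Q"
    by (intro the_equality) (auto simp: fun_eq_iff intro: blinfun_eqI)
  moreover have "blinfun_apply P ` dom A \<subseteq> dom (adjoint_op B)" using adj by blast
  ultimately show ?thesis by (simp add: lyapunov_generator_def)
qed

lemma generator_apply_linear:
  assumes "x \<in> dom A"
  shows "y \<in> dom A \<Longrightarrow> the (A (x + y)) = the (A x) + the (A y)"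
    and "the (A (c *\<^sub>R x)) = c *\<^sub>R the (A x)"
proof -
  obtain v where v: "A x = Some v" using assms by blast
  show "the (A (c *\<^sub>R x)) = c *\<^sub>R the (A x)"
    using T.generator_linear(2)[OF v v] v by simp
  assume "y \<in> dom A"
  then obtain w where w: "A y = Some w" by blast
  show "the (A (x + y)) = the (A x) + the (A y)"
    using T.generator_linear(1)[OF v w] v w by simp
qed

text \<open>\<open>Q\<close> is the bounded extension of \<open>L\<close> from the dense domain of
  \<open>A\<close>. Linearity of \<open>L\<close> is checked by pairing with \<open>dom B\<close>,
  where the adjoint is explicit.\<close>

lemma lyapunov_generator_domD:
  assumes "P \<in> dom (lyapunov_generator A B)"
  shows "\<exists>Q. lyapunov_eq P Q"
proof -
  define L where "L x = the (adjoint_op B (blinfun_apply P x)) + blinfun_apply P (the (A x))" for x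
  have adj_dom: "blinfun_apply P x \<in> dom (adjoint_op B)" if "x \<in> dom A" for x
    using assms that by (simp add: lyapunov_generator_def domIff image_subset_iff split: if_splits)
  have op: "lyapunov_op A B P x = (if x \<in> dom A then Some (L x) else None)" for x
    using adj_dom by (simp add: lyapunov_op_def L_def)
  then have dom_op: "dom (lyapunov_op A B P) = dom A"
    by (auto split: if_splits)
  have "bounded_op (lyapunov_op A B P)"
    using assms by (auto simp: lyapunov_generator_def split: if_splits)
  then obtain C where C: "\<And>x. x \<in> dom A \<Longrightarrow> norm (L x) \<le> C * norm x"
    unfolding bounded_op_def dom_op by (auto simp: op)
  have L_apply: "blinfun_apply (L x) y = blinfun_apply (blinfun_apply P x) (the (B y)) +
      blinfun_apply (blinfun_apply P (the (A x))) y" if x: "x \<in> dom A" and y: "y \<in> dom B" for x y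
  proof -
    obtain g where g: "adjoint_op B (blinfun_apply P x) = Some g" using adj_dom[OF x] by blast
    have "blinfun_apply (blinfun_apply P x) (the (B y)) = blinfun_apply g y"
      using g[unfolded adjoint_op_eq_Some_iff[OF S.dense_dom]] y by (rule bspec)
    then show ?thesis by (simp add: L_def g blinfun.add_left)
  qed
  have dual_eqI: "f = g" if "\<And>y. y \<in> dom B \<Longrightarrow> blinfun_apply f y = blinfun_apply g y" for f g :: "'b dual"
  proof (rule blinfun_eqI)
    fix y
    show "blinfun_apply f y = blinfun_apply g y"
      by (rule continuous_eq_on_dense[OF _ _ S.dense_dom]) (use that in \<open>auto intro!: continuous_intros\<close>)
  qed
  obtain Q where Q: "\<And>x. x \<in> dom A \<Longrightarrow> blinfun_apply Q x = L x"
  proof (rule bounded_linear_extension[OF T.subspace_dom T.dense_dom])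
    show "L (x + y) = L x + L y" if "x \<in> dom A" "y \<in> dom A" for x y
    proof (rule dual_eqI)
      fix z assume z: "z \<in> dom B"
      show "blinfun_apply (L (x + y)) z = blinfun_apply (L x + L y) z"
        unfolding blinfun.add_left[of "L x" "L y"] L_apply[OF subspace_add[OF T.subspace_dom that] z]
          L_apply[OF that(1) z] L_apply[OF that(2) z] generator_apply_linear(1)[OF that]
        by (simp add: blinfun.add_right blinfun.add_left)
    qed
    show "L (c *\<^sub>R x) = c *\<^sub>R L x" if "x \<in> dom A" for c x
    proof (rule dual_eqI)
      fix z assume z: "z \<in> dom B"
      show "blinfun_apply (L (c *\<^sub>R x)) z = blinfun_apply (c *\<^sub>R L x) z"
        unfolding blinfun.scaleR_left[of c "L x"] L_apply[OF subspace_scale[OF T.subspace_dom that] z]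
          L_apply[OF that z] generator_apply_linear(2)[OF that]
        by (simp add: blinfun.scaleR_right blinfun.scaleR_left algebra_simps)
    qed
  qed (use C in auto)
  then have "lyapunov_eq P Q" unfolding lyapunov_eq_def using L_apply by simp
  then show ?thesis by blast
qed

section \<open>Orbits of the implemented semigroup and the mean value estimate\<close>

abbreviation orbit :: "('a \<Rightarrow>\<^sub>L 'b dual) \<Rightarrow> 'a \<Rightarrow> 'b \<Rightarrow> real \<Rightarrow> real" where
  "orbit P x y t \<equiv> blinfun_apply (blinfun_apply P (blinfun_apply (T t) x)) (blinfun_apply (S t) y)"

lemma implemented_semigroup_apply:
  "blinfun_apply (blinfun_apply (implemented_semigroup T S t P) x) y = orbit P x y t"
  by (simp add: implemented_semigroup_def)

lemma orbit_has_vector_derivative: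
  assumes v: "A x = Some v" and w: "B y = Some w" and t: "t \<in> {0..\<delta>}"
  shows "(orbit P x y has_vector_derivative
    blinfun_apply (blinfun_apply P (blinfun_apply (T t) x)) (blinfun_apply (S t) w) +
    blinfun_apply (blinfun_apply P (blinfun_apply (T t) v)) (blinfun_apply (S t) y)) (at t within {0..\<delta>})"
  by (intro blinfun.has_vector_derivative S.generator_has_vector_derivative[OF w t]
      bounded_linear.has_vector_derivative[OF blinfun.bounded_linear_right]
      T.generator_has_vector_derivative[OF v t])

text \<open>The product rule gives the two terms of the identity at the points \<open>T t x\<close>
  and \<open>S t y\<close>, which still lie in the domains by invariance.\<close>

lemma orbit_has_vector_derivative_lyapunov:
  assumes PQ: "lyapunov_eq P Q" and x: "x \<in> dom A" and y: "y \<in> dom B" and t: "t \<in> {0..\<delta>}"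
  shows "(orbit P x y has_vector_derivative orbit Q x y t) (at t within {0..\<delta>})"
proof -
  obtain v w where v: "A x = Some v" and w: "B y = Some w" using x y by blast
  have "A (blinfun_apply (T t) x) = Some (blinfun_apply (T t) v)"
    "B (blinfun_apply (S t) y) = Some (blinfun_apply (S t) w)"
    using T.generator_invariant[OF v] S.generator_invariant[OF w] t by auto
  then have "orbit Q x y t =
      blinfun_apply (blinfun_apply P (blinfun_apply (T t) x)) (blinfun_apply (S t) w) +
      blinfun_apply (blinfun_apply P (blinfun_apply (T t) v)) (blinfun_apply (S t) y)"
    using PQ unfolding lyapunov_eq_def by force
  then show ?thesis using orbit_has_vector_derivative[OF v w t] by simp
qed

text \<open>Mean value inequality for \<open>s \<mapsto> orbit P x y s - s * L\<close>. The constant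
  \<open>L\<close> is free, so it can stay fixed when \<open>x\<close> and \<open>y\<close> are
  approximated.\<close>

lemma orbit_diff_bound_dom:
  assumes PQ: "lyapunov_eq P Q" and x: "x \<in> dom A" and y: "y \<in> dom B"
    and t: "0 \<le> t" "t \<le> \<delta>"
    and bound: "\<And>s. 0 \<le> s \<Longrightarrow> s \<le> t \<Longrightarrow> \<bar>orbit Q x y s - L\<bar> \<le> c"
  shows "\<bar>orbit P x y t - orbit P x y 0 - t * L\<bar> \<le> c * t"
proof -
  let ?f = "\<lambda>s. orbit P x y s - s * L"
  have "norm (?f t - ?f 0) \<le> c * norm (t - 0)"
  proof (rule field_differentiable_bound[of "{0..t}"])
    fix s assume s: "s \<in> {0..t}"
    have "(orbit P x y has_vector_derivative orbit Q x y s) (at s within {0..t})"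
      by (rule has_vector_derivative_within_subset[OF orbit_has_vector_derivative_lyapunov[OF PQ x y]])
        (use s t in auto)
    then show "(?f has_field_derivative (orbit Q x y s - 1 * L)) (at s within {0..t})"
      unfolding has_real_derivative_iff_has_vector_derivative[symmetric]
      by (intro DERIV_diff DERIV_cmult_right DERIV_ident) auto
    show "norm (orbit Q x y s - 1 * L) \<le> c" using bound s by simp
  qed (use t in auto)
  then show ?thesis using t by (simp add: algebra_simps)
qed

text \<open>Bilinearity changes one argument at a time. The bound does not involve \<open>s\<close>,
  which is what the passage to the limit requires.\<close>

lemma orbit_diff_le:
  assumes s: "0 \<le> s" "s \<le> \<delta>"
  shows "\<bar>orbit Q x' y' s - orbit Q x y s\<bar> \<le>
    norm Q * (M * norm (x' - x)) * (M * norm y') + norm Q * (M * norm x) * (M * norm (y' - y))"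
proof -
  have le: "\<bar>orbit Q u v s\<bar> \<le> norm Q * (M * norm u) * (M * norm v)" for u v
  proof -
    have "norm (blinfun_apply Q (blinfun_apply (T s) u)) \<le> norm Q * (M * norm u)"
      by (rule order_trans[OF norm_blinfun mult_left_mono[OF T.apply_le]]) (use s in auto)
    then have "norm (orbit Q u v s) \<le> norm Q * (M * norm u) * (M * norm v)"
      by (rule order_trans[OF norm_blinfun mult_mono])
        (use s T.M_nonneg S.apply_le in auto)
    then show ?thesis by simp
  qed
  have "orbit Q x' y' s - orbit Q x y s = orbit Q (x' - x) y' s + orbit Q x (y' - y) s"
    by (simp add: blinfun.diff_right blinfun.diff_left)
  then show ?thesis using le[of "x' - x" y'] le[of x "y' - y"] by linarith
qed

text \<open>
  The perturbation of \<open>orbit Q x y s\<close> caused by replacing \<open>x\<close>, \<open>y\<close> with nearby points of the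
  domains is small uniformly in \<open>s\<close>, so the mean value estimate survives the limit.
\<close>

lemma orbit_diff_bound:
  assumes PQ: "lyapunov_eq P Q" and t: "0 \<le> t" "t \<le> \<delta>"
    and bound: "\<And>s. 0 \<le> s \<Longrightarrow> s \<le> t \<Longrightarrow> \<bar>orbit Q x y s - L\<bar> \<le> c"
  shows "\<bar>orbit P x y t - orbit P x y 0 - t * L\<bar> \<le> c * t"
proof -
  have "x \<in> closure (dom A)" "y \<in> closure (dom B)"
    using T.dense_dom S.dense_dom by auto
  then obtain u v where u: "\<And>n. u n \<in> dom A" "u \<longlonglongrightarrow> x" and v: "\<And>n. v n \<in> dom B" "v \<longlonglongrightarrow> y"
    unfolding closure_sequential by blast
  let ?e = "\<lambda>n. norm Q * (M * norm (u n - x)) * (M * norm (v n)) +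
    norm Q * (M * norm x) * (M * norm (v n - y))"
  have e: "?e \<longlonglongrightarrow> norm Q * (M * norm (x - x)) * (M * norm y) + norm Q * (M * norm x) * (M * norm (y - y))"
    by (intro tendsto_intros u v)
  have le: "\<bar>orbit P (u n) (v n) t - orbit P (u n) (v n) 0 - t * L\<bar> \<le> (c + ?e n) * t" for n
  proof (rule orbit_diff_bound_dom[OF PQ u(1) v(1) t])
    fix s assume s: "0 \<le> s" "s \<le> t"
    then have "\<bar>orbit Q (u n) (v n) s - orbit Q x y s\<bar> \<le> ?e n"
      using t by (intro orbit_diff_le) auto
    then show "\<bar>orbit Q (u n) (v n) s - L\<bar> \<le> c + ?e n"
      using bound[OF s] by linarith
  qed
  have "(\<lambda>n. \<bar>orbit P (u n) (v n) t - orbit P (u n) (v n) 0 - t * L\<bar>) \<longlonglongrightarrow>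
      \<bar>orbit P x y t - orbit P x y 0 - t * L\<bar>"
    by (intro tendsto_rabs tendsto_diff tendsto_const blinfun.tendsto u v)
  moreover have "(\<lambda>n. (c + ?e n) * t) \<longlonglongrightarrow> c * t"
    using tendsto_mult[OF tendsto_add[OF tendsto_const[of c] e] tendsto_const[of t]] by simp
  ultimately show ?thesis by (rule LIMSEQ_le) (use le in blast)
qed

section \<open>Limits of the difference quotients\<close>

abbreviation quotient :: "('a \<Rightarrow>\<^sub>L 'b dual) \<Rightarrow> real \<Rightarrow> ('a \<Rightarrow>\<^sub>L 'b dual)" where
  "quotient P t \<equiv> (1 / t) *\<^sub>R (implemented_semigroup T S t P - P)"

lemma quotient_apply:
  "blinfun_apply (blinfun_apply (quotient P t) x) y = (1 / t) * (orbit P x y t - orbit P x y 0)"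
  by (simp add: blinfun.scaleR_left blinfun.diff_left implemented_semigroup_apply)

lemma quotient_diff_bound:
  assumes PQ: "lyapunov_eq P Q" and t: "0 < t" "t \<le> \<delta>"
    and bound: "\<And>s. 0 \<le> s \<Longrightarrow> s \<le> t \<Longrightarrow> \<bar>orbit Q x y s - orbit Q x y 0\<bar> \<le> c"
  shows "\<bar>blinfun_apply (blinfun_apply (quotient P t) x) y - blinfun_apply (blinfun_apply Q x) y\<bar> \<le> c"
proof -
  let ?L = "blinfun_apply (blinfun_apply Q x) y"
  have "\<bar>orbit P x y t - orbit P x y 0 - t * ?L\<bar> \<le> c * t"
    using orbit_diff_bound[OF PQ, of t x y ?L c] t bound by simp
  then have "\<bar>orbit P x y t - orbit P x y 0 - t * ?L\<bar> / t \<le> c"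
    using t by (simp add: divide_le_eq)
  moreover have "blinfun_apply (blinfun_apply (quotient P t) x) y - ?L =
      (orbit P x y t - orbit P x y 0 - t * ?L) / t"
    unfolding quotient_apply using t by (simp add: field_simps)
  ultimately show ?thesis using t by (simp add: abs_divide)
qed

lemma weak_limit_lyapunov_eq:
  assumes "\<And>x y. ((\<lambda>t. blinfun_apply (blinfun_apply (quotient P t) x) y) \<longlongrightarrow>
    blinfun_apply (blinfun_apply Q x) y) (at_right 0)"
  shows "lyapunov_eq P Q"
  unfolding lyapunov_eq_def
proof (intro ballI)
  fix x y assume "x \<in> dom A" "y \<in> dom B"
  then obtain v w where v: "A x = Some v" and w: "B y = Some w" by blast
  have "((\<lambda>t. (1 / t) *\<^sub>R (orbit P x y (0 + t) - orbit P x y 0)) \<longlongrightarrow>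
      blinfun_apply (blinfun_apply P x) w + blinfun_apply (blinfun_apply P v) y) (at_right 0)"
    using has_vector_derivative_right_quotient[OF orbit_has_vector_derivative[OF v w, of 0]]
      T.delta_pos by simp
  then have "((\<lambda>t. blinfun_apply (blinfun_apply (quotient P t) x) y) \<longlongrightarrow>
      blinfun_apply (blinfun_apply P x) w + blinfun_apply (blinfun_apply P v) y) (at_right 0)"
    unfolding quotient_apply by simp
  from tendsto_unique[OF _ this assms] v w
  show "blinfun_apply (blinfun_apply P x) (the (B y)) +
     blinfun_apply (blinfun_apply P (the (A x))) y = blinfun_apply (blinfun_apply Q x) y" by simp
qed

text \<open>The mean value estimate asks for a bound on all of \<open>[0, t]\<close>, endpoint
  included; \<open>g 0 = 0\<close> covers the point that the right-hand limit ignores.\<close>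

lemma eventually_uniform_le:
  fixes g :: "real \<Rightarrow> real"
  assumes "(g \<longlongrightarrow> 0) (at_right 0)" "g 0 = 0" "e > 0"
  shows "\<forall>\<^sub>F t in at_right 0. 0 < t \<and> t \<le> \<delta> \<and> (\<forall>s. 0 \<le> s \<longrightarrow> s \<le> t \<longrightarrow> g s \<le> e)"
proof -
  have "\<forall>\<^sub>F s in at_right 0. g s < e" by (rule order_tendstoD(2)[OF assms(1,3)])
  then obtain b where b: "b > 0" "\<And>s. 0 < s \<Longrightarrow> s < b \<Longrightarrow> g s < e"
    unfolding eventually_at_right[OF zero_less_one] by blast
  have "g s \<le> e" if "0 \<le> s" "s < b" for s
    using b(2)[of s] that assms(2,3) by (cases "s = 0") auto
  then show ?thesis
    using b(1) T.delta_pos by (intro eventually_at_rightI[of 0 "min b \<delta>"]) auto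
qed

lemma lyapunov_eq_weak_limit:
  assumes PQ: "lyapunov_eq P Q"
  shows "((\<lambda>t. blinfun_apply (blinfun_apply (quotient P t) x) y) \<longlongrightarrow>
    blinfun_apply (blinfun_apply Q x) y) (at_right 0)"
proof (rule tendstoI)
  fix e :: real assume e: "e > 0"
  have "((\<lambda>s. \<bar>orbit Q x y s - blinfun_apply (blinfun_apply Q x) y\<bar>) \<longlongrightarrow> 0) (at_right 0)"
    by (intro tendsto_rabs_zero LIM_zero blinfun.tendsto tendsto_const T.tendsto_zero S.tendsto_zero)
  then have "((\<lambda>s. \<bar>orbit Q x y s - orbit Q x y 0\<bar>) \<longlongrightarrow> 0) (at_right 0)" by simp
  \<comment> \<open>The estimate yields only a weak inequality, so \<open>e / 2\<close> leaves room
    for the strict one.\<close>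
  from eventually_uniform_le[OF this, of "e / 2"] e
  have "\<forall>\<^sub>F t in at_right 0. 0 < t \<and> t \<le> \<delta> \<and>
      (\<forall>s. 0 \<le> s \<longrightarrow> s \<le> t \<longrightarrow> \<bar>orbit Q x y s - orbit Q x y 0\<bar> \<le> e / 2)" by simp
  then show "\<forall>\<^sub>F t in at_right 0. dist (blinfun_apply (blinfun_apply (quotient P t) x) y)
      (blinfun_apply (blinfun_apply Q x) y) < e"
  proof eventually_elim
    case (elim t)
    then have "\<bar>blinfun_apply (blinfun_apply (quotient P t) x) y - blinfun_apply (blinfun_apply Q x) y\<bar> \<le> e / 2"
      by (intro quotient_diff_bound[OF PQ]) auto
    then show ?case using e by (simp only: dist_real_def)
  qed
qed

text \<open>The deviation of \<open>orbit Q x y s\<close> from its value at \<open>0\<close> is at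
  most \<open>?g s * norm y\<close>, so the mean value estimate is uniform in \<open>y\<close> and
  bounds the dual norm. \<open>?g\<close> tends to \<open>0\<close> by continuity of
  \<open>T\<close> at \<open>x\<close> and of the adjoint semigroup at \<open>Q x\<close>.\<close>

lemma lyapunov_eq_strong_limit:
  assumes PQ: "lyapunov_eq P Q"
    and adj: "\<And>f :: 'b dual. ((\<lambda>t. f o\<^sub>L S t) \<longlongrightarrow> f) (at_right 0)"
  shows "((\<lambda>t. blinfun_apply (quotient P t) x) \<longlongrightarrow> blinfun_apply Q x) (at_right 0)"
proof (rule tendstoI)
  fix e :: real assume e: "e > 0"
  let ?g = "\<lambda>s. norm ((blinfun_apply Q (blinfun_apply (T s) x) o\<^sub>L S s) - blinfun_apply Q x)"
  let ?h = "\<lambda>s. norm Q * norm (blinfun_apply (T s) x - x) * M + norm ((blinfun_apply Q x o\<^sub>L S s) - blinfun_apply Q x)"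
  have g_le: "?g s \<le> ?h s" if "0 < s" "s < \<delta>" for s
  proof -
    have "(blinfun_apply Q (blinfun_apply (T s) x) o\<^sub>L S s) - blinfun_apply Q x =
      (blinfun_apply Q (blinfun_apply (T s) x - x) o\<^sub>L S s) + ((blinfun_apply Q x o\<^sub>L S s) - blinfun_apply Q x)"
      by (rule blinfun_eqI) (simp add: blinfun.diff_left blinfun.add_left blinfun.diff_right)
    moreover have "norm (blinfun_apply Q (blinfun_apply (T s) x - x) o\<^sub>L S s) \<le>
        norm Q * norm (blinfun_apply (T s) x - x) * M"
      by (rule order_trans[OF norm_blinfun_compose mult_mono]) (use that S.bounded in \<open>auto intro: norm_blinfun\<close>)
    ultimately show ?thesis by (simp only: norm_triangle_mono order_refl)
  qed
  have "(?h \<longlongrightarrow> 0) (at_right 0)"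
    by (intro tendsto_add_zero tendsto_mult_left_zero tendsto_mult_right_zero tendsto_norm_zero LIM_zero
        adj T.tendsto_zero)
  moreover have "\<forall>\<^sub>F s in at_right 0. ?g s \<le> ?h s"
    by (rule eventually_at_rightI[OF _ T.delta_pos]) (use g_le in simp)
  ultimately have "((\<lambda>s. (blinfun_apply Q (blinfun_apply (T s) x) o\<^sub>L S s) - blinfun_apply Q x) \<longlongrightarrow> 0) (at_right 0)"
    by (rule Lim_null_comparison[rotated])
  then have "(?g \<longlongrightarrow> 0) (at_right 0)" by (rule tendsto_norm_zero)
  moreover have "?g 0 = 0" by (simp add: blinfun_compose_id)
  moreover have "e / 2 > 0" using e by simp
  ultimately have "\<forall>\<^sub>F t in at_right 0. 0 < t \<and> t \<le> \<delta> \<and> (\<forall>s. 0 \<le> s \<longrightarrow> s \<le> t \<longrightarrow> ?g s \<le> e / 2)"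
    by (rule eventually_uniform_le)
  then show "\<forall>\<^sub>F t in at_right 0. dist (blinfun_apply (quotient P t) x) (blinfun_apply Q x) < e"
  proof eventually_elim
    case (elim t)
    have "norm (blinfun_apply (quotient P t) x - blinfun_apply Q x) \<le> e / 2"
    proof (rule norm_blinfun_bound)
      fix y
      have "\<bar>orbit Q x y s - orbit Q x y 0\<bar> \<le> e / 2 * norm y" if s: "0 \<le> s" "s \<le> t" for s
      proof -
        have "orbit Q x y s - orbit Q x y 0 =
          blinfun_apply ((blinfun_apply Q (blinfun_apply (T s) x) o\<^sub>L S s) - blinfun_apply Q x) y"
          by (simp add: blinfun.diff_left)
        also have "norm \<dots> \<le> ?g s * norm y" by (rule norm_blinfun)
        also have "\<dots> \<le> e / 2 * norm y" using elim s by (intro mult_right_mono) auto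
        finally show ?thesis by simp
      qed
      then have "\<bar>blinfun_apply (blinfun_apply (quotient P t) x) y - blinfun_apply (blinfun_apply Q x) y\<bar>
          \<le> e / 2 * norm y"
        using elim by (intro quotient_diff_bound[OF PQ]) auto
      then show "norm (blinfun_apply (blinfun_apply (quotient P t) x - blinfun_apply Q x) y) \<le> e / 2 * norm y"
        by (simp only: blinfun.diff_left real_norm_def)
    qed (use e in simp)
    then show ?case using e by (simp only: dist_norm)
  qed
qed

end

subsection \<open>The adjoint semigroup on a reflexive space\<close>

context local_semigroup
begin

text \<open>The space known as the sun dual of the semigroup.\<close>

definition adjoint_continuous :: "'a dual set" where
  "adjoint_continuous = {f. ((\<lambda>t. f o\<^sub>L T t) \<longlongrightarrow> f) (at_right 0)}"

lemma subspace_adjoint_continuous: "subspace adjoint_continuous"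
proof -
  have "((\<lambda>t. (f + g) o\<^sub>L T t) \<longlongrightarrow> f + g) (at_right 0)"
    if "((\<lambda>t. f o\<^sub>L T t) \<longlongrightarrow> f) (at_right 0)" "((\<lambda>t. g o\<^sub>L T t) \<longlongrightarrow> g) (at_right 0)" for f g :: "'a dual"
    using tendsto_add[OF that]
    by (simp add: bounded_bilinear.add_left[OF bounded_bilinear_blinfun_compose])
  moreover have "((\<lambda>t. (c *\<^sub>R f) o\<^sub>L T t) \<longlongrightarrow> c *\<^sub>R f) (at_right 0)"
    if "((\<lambda>t. f o\<^sub>L T t) \<longlongrightarrow> f) (at_right 0)" for c and f :: "'a dual"
    using tendsto_scaleR[OF tendsto_const[of c] that]
    by (simp add: bounded_bilinear.scaleR_left[OF bounded_bilinear_blinfun_compose])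
  ultimately show ?thesis
    by (simp add: subspace_def adjoint_continuous_def bounded_bilinear.zero_left[OF bounded_bilinear_blinfun_compose])
qed

lemma closed_adjoint_continuous: "closed adjoint_continuous"
proof -
  have "f \<in> adjoint_continuous" if f: "f \<in> closure adjoint_continuous" for f
    unfolding adjoint_continuous_def
  proof (intro CollectI tendstoI)
    fix e :: real assume e: "e > 0"
    \<comment> \<open>The three terms below contribute \<open>d * M\<close>, \<open>d\<close> and
      \<open>d\<close>, in total \<open>e / 2\<close>.\<close>
    define d where "d = e / (2 * (M + 2))"
    have d: "d > 0" using e M_nonneg by (simp add: d_def)
    then obtain g where g: "g \<in> adjoint_continuous" "dist g f < d"
      using f unfolding closure_approachable by blast
    have "\<forall>\<^sub>F t in at_right 0. dist (g o\<^sub>L T t) g < d"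
      using g(1) d unfolding adjoint_continuous_def tendsto_iff by blast
    moreover have "\<forall>\<^sub>F t in at_right 0. 0 \<le> t \<and> t \<le> \<delta>"
      by (rule eventually_at_rightI[OF _ delta_pos]) simp
    ultimately show "\<forall>\<^sub>F t in at_right 0. dist (f o\<^sub>L T t) f < e"
    proof eventually_elim
      case (elim t)
      have fg: "norm (f - g) \<le> d" using g(2) by (simp add: dist_norm norm_minus_commute)
      have "(f o\<^sub>L T t) - f = ((f - g) o\<^sub>L T t) + (((g o\<^sub>L T t) - g) + (g - f))"
        by (simp add: bounded_bilinear.diff_left[OF bounded_bilinear_blinfun_compose])
      also have "norm \<dots> \<le> d * M + (d + d)"
      proof (intro norm_triangle_mono)
        show "norm ((f - g) o\<^sub>L T t) \<le> d * M"
          by (rule order_trans[OF norm_blinfun_compose mult_mono]) (use elim fg bounded d in auto)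
      qed (use elim g(2) in \<open>auto simp: dist_norm\<close>)
      also have "\<dots> = d * (M + 2)" by (simp add: algebra_simps)
      also have "\<dots> = e / 2" using M_nonneg by (simp add: d_def field_simps)
      finally show ?case using e by (simp add: dist_norm)
    qed
  qed
  then show ?thesis by (meson closure_subset_eq subsetI)
qed

text \<open>Composing the integral with \<open>T t\<close> changes it by the integrals over
  \<open>[h, h + t]\<close> and \<open>[0, t]\<close>, each at most \<open>M * norm x * t\<close>.
  This is uniform in \<open>x\<close>, hence a bound in the dual norm.\<close>

lemma orbit_integral_adjoint_continuous:
  fixes f :: "'a dual"
  assumes h: "0 \<le> h" "h < \<delta>"
  shows "f o\<^sub>L Blinfun (orbit_integral h) \<in> adjoint_continuous"
proof -
  let ?J = "Blinfun (orbit_integral h)"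
  have J: "blinfun_apply ?J = orbit_integral h"
    by (rule bounded_linear_Blinfun_apply[OF bounded_linear_orbit_integral]) (use h in auto)
  have bound: "norm ((f o\<^sub>L ?J o\<^sub>L T t) - (f o\<^sub>L ?J)) \<le> 2 * norm f * M * t"
    if t: "0 < t" "t < \<delta> - h" for t
  proof (rule norm_blinfun_bound)
    show "0 \<le> 2 * norm f * M * t" using t M_nonneg by simp
    fix x
    have "orbit_integral h (blinfun_apply (T t) x) = blinfun_apply (T t) (orbit_integral h x)"
    proof -
      have "blinfun_apply (T s) (blinfun_apply (T t) x) = blinfun_apply (T t) (blinfun_apply (T s) x)"
        if "0 \<le> s" for s
        using add[of s t x] add[of t s x] that t by (simp add: add.commute)
      then have "orbit_integral h (blinfun_apply (T t) x) =
          integral {0..h} (blinfun_apply (T t) \<circ> (\<lambda>s. blinfun_apply (T s) x))"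
        unfolding orbit_integral_def by (intro integral_cong) simp
      also have "\<dots> = blinfun_apply (T t) (orbit_integral h x)"
        unfolding orbit_integral_def
        by (rule integral_linear) (use h integrable in \<open>auto intro: blinfun.bounded_linear_right\<close>)
      finally show ?thesis .
    qed
    also have "\<dots> = orbit_integral (h + t) x - orbit_integral t x"
      using h t by (intro apply_orbit_integral) auto
    finally have "orbit_integral h (blinfun_apply (T t) x) - orbit_integral h x =
        (orbit_integral (h + t) x - orbit_integral h x) - (orbit_integral t x - orbit_integral 0 x)"
      by (simp add: orbit_integral_def)
    also have "norm \<dots> \<le> M * norm x * t + M * norm x * t"
      using orbit_integral_diff_le[of h "h + t" x] orbit_integral_diff_le[of 0 t x] h t
      by (intro order_trans[OF norm_triangle_ineq4 add_mono]) auto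
    finally have le: "norm (orbit_integral h (blinfun_apply (T t) x) - orbit_integral h x) \<le> 2 * (M * norm x * t)"
      by linarith
    have "blinfun_apply ((f o\<^sub>L ?J o\<^sub>L T t) - (f o\<^sub>L ?J)) x =
        blinfun_apply f (orbit_integral h (blinfun_apply (T t) x) - orbit_integral h x)"
      by (simp add: blinfun.diff_left blinfun.diff_right J)
    also have "norm \<dots> \<le> norm f * (2 * (M * norm x * t))"
      by (rule order_trans[OF norm_blinfun mult_left_mono[OF le]]) simp
    finally show "norm (blinfun_apply ((f o\<^sub>L ?J o\<^sub>L T t) - (f o\<^sub>L ?J)) x) \<le> 2 * norm f * M * t * norm x"
      by (simp add: mult_ac)
  qed
  have "((\<lambda>t. 2 * norm f * M * t) \<longlongrightarrow> 0) (at_right 0)"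
    by (rule tendsto_mult_right_zero[OF tendsto_ident_at])
  moreover have "\<forall>\<^sub>F t in at_right 0. norm ((f o\<^sub>L ?J o\<^sub>L T t) - (f o\<^sub>L ?J)) \<le> 2 * norm f * M * t"
    by (rule eventually_at_rightI[of 0 "\<delta> - h"]) (use bound h in auto)
  ultimately have "((\<lambda>t. (f o\<^sub>L ?J o\<^sub>L T t) - (f o\<^sub>L ?J)) \<longlongrightarrow> 0) (at_right 0)"
    by (rule Lim_null_comparison[rotated])
  then show ?thesis by (simp add: adjoint_continuous_def LIM_zero_cancel)
qed

lemma adjoint_strongly_continuous:
  fixes f :: "'a dual"
  assumes refl: "reflexive_space TYPE('a)"
  shows "((\<lambda>t. f o\<^sub>L T t) \<longlongrightarrow> f) (at_right 0)"
proof -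
  have "f \<in> adjoint_continuous"
  proof (rule ccontr)
    assume "f \<notin> adjoint_continuous"
    then obtain \<phi> :: "'a dual dual" where zero: "\<And>g. g \<in> adjoint_continuous \<Longrightarrow> blinfun_apply \<phi> g = 0"
      and nz: "blinfun_apply \<phi> f \<noteq> 0"
      using separating_functional[OF subspace_adjoint_continuous closed_adjoint_continuous] by blast
    \<comment> \<open>Reflexivity turns \<open>\<phi>\<close> into evaluation at a point
      \<open>y\<close>, so its vanishing on \<open>f o\<^sub>L Blinfun (orbit_integral h)\<close>
      becomes a statement about the averages of the orbit of \<open>y\<close>.\<close>
    obtain y where y: "\<phi> = canonical_embedding y"
      using refl unfolding reflexive_space_def surj_def by blast
    have "blinfun_apply f ((1 / h) *\<^sub>R orbit_integral h y) = 0" if "0 < h" "h < \<delta>" for h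
    proof -
      have "blinfun_apply (Blinfun (orbit_integral h)) y = orbit_integral h y"
        using bounded_linear_Blinfun_apply[OF bounded_linear_orbit_integral] that by simp
      then have "blinfun_apply f (orbit_integral h y) = blinfun_apply \<phi> (f o\<^sub>L Blinfun (orbit_integral h))"
        by (simp add: y)
      then show ?thesis
        using zero[OF orbit_integral_adjoint_continuous[of h f]] that by (simp add: blinfun.scaleR_right)
    qed
    then have "\<forall>\<^sub>F h in at_right 0. blinfun_apply f ((1 / h) *\<^sub>R orbit_integral h y) = 0"
      by (intro eventually_at_rightI[OF _ delta_pos]) simp
    then have "((\<lambda>h. blinfun_apply f ((1 / h) *\<^sub>R orbit_integral h y)) \<longlongrightarrow> 0) (at_right 0)"
      by (rule tendsto_eventually)
    moreover have "((\<lambda>h. blinfun_apply f ((1 / h) *\<^sub>R orbit_integral h y)) \<longlongrightarrow> blinfun_apply f y) (at_right 0)"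
      by (rule blinfun.tendsto[OF tendsto_const average_tendsto])
    ultimately have "blinfun_apply f y = 0"
      by (intro tendsto_unique[OF trivial_limit_at_right_real])
    then show False using nz by (simp add: y)
  qed
  then show ?thesis by (simp add: adjoint_continuous_def)
qed

end

subsection \<open>The generators of the implemented semigroup\<close>

lemma weak_star_limit_unique:
  fixes l l' :: "'a::real_normed_vector \<Rightarrow>\<^sub>L 'b::real_normed_vector dual" and F :: "real filter"
  assumes F: "F \<noteq> bot" and l: "limitin weak_star_operator_topology f l F"
    and l': "limitin weak_star_operator_topology f l' F"
  shows "l = l'"
proof (intro blinfun_eqI)
  fix x y
  show "blinfun_apply (blinfun_apply l x) y = blinfun_apply (blinfun_apply l' x) y"
    using l l' unfolding limitin_weak_star_operator_topology by (blast intro: tendsto_unique[OF F])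
qed

lemma strong_limit_unique:
  assumes F: "F \<noteq> bot" and l: "limitin strong_operator_topology f l F"
    and l': "limitin strong_operator_topology f l' F"
  shows "l = l'"
proof (rule blinfun_eqI)
  fix x
  show "blinfun_apply l x = blinfun_apply l' x"
    using l l' unfolding limitin_strong_operator_topology by (blast intro: tendsto_unique[OF F])
qed

context implemented
begin

lemma lyapunov_generator_iff: "lyapunov_generator A B P = Some Q \<longleftrightarrow> lyapunov_eq P Q"
proof
  assume PQ: "lyapunov_generator A B P = Some Q"
  then obtain Q' where "lyapunov_eq P Q'" using lyapunov_generator_domD by blast
  \<comment> \<open>\<open>Q'\<close> determines the value of the generator at \<open>P\<close>, so
    it coincides with \<open>Q\<close>.\<close>
  then show "lyapunov_eq P Q" using lyapunov_generator_eq_Some PQ by force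
qed (rule lyapunov_generator_eq_Some)

lemma weak_star_generator:
  "generator_wrt weak_star_operator_topology (implemented_semigroup T S) = lyapunov_generator A B"
proof
  fix P
  have "generator_wrt weak_star_operator_topology (implemented_semigroup T S) P = Some Q \<longleftrightarrow>
      lyapunov_generator A B P = Some Q" for Q
  proof -
    have "generator_wrt weak_star_operator_topology (implemented_semigroup T S) P = Some Q \<longleftrightarrow>
        limitin weak_star_operator_topology (quotient P) Q (at_right 0)"
      by (rule generator_wrt_eq_Some_iff) (rule weak_star_limit_unique[OF trivial_limit_at_right_real])
    also have "\<dots> \<longleftrightarrow> lyapunov_eq P Q"
      unfolding limitin_weak_star_operator_topology
      using weak_limit_lyapunov_eq lyapunov_eq_weak_limit by blast
    finally show ?thesis unfolding lyapunov_generator_iff .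
  qed
  then show "generator_wrt weak_star_operator_topology (implemented_semigroup T S) P =
      lyapunov_generator A B P" by (metis not_Some_eq)
qed

lemma strong_generator:
  assumes refl: "reflexive_space TYPE('b)"
  shows "generator_wrt strong_operator_topology (implemented_semigroup T S) = lyapunov_generator A B"
proof
  fix P
  have "generator_wrt strong_operator_topology (implemented_semigroup T S) P = Some Q \<longleftrightarrow>
      lyapunov_generator A B P = Some Q" for Q
  proof -
    have "generator_wrt strong_operator_topology (implemented_semigroup T S) P = Some Q \<longleftrightarrow>
        limitin strong_operator_topology (quotient P) Q (at_right 0)"
      by (rule generator_wrt_eq_Some_iff) (rule strong_limit_unique[OF trivial_limit_at_right_real])
    also have "\<dots> \<longleftrightarrow> lyapunov_eq P Q"
      unfolding limitin_strong_operator_topology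
    proof
      assume "\<forall>x. ((\<lambda>t. blinfun_apply (quotient P t) x) \<longlongrightarrow> blinfun_apply Q x) (at_right 0)"
      then show "lyapunov_eq P Q"
        \<comment> \<open>Evaluation at \<open>y\<close> is norm continuous, so strong convergence
          implies weak-star convergence.\<close>
        by (intro weak_limit_lyapunov_eq) (rule blinfun.tendsto[OF _ tendsto_const], simp)
    next
      assume "lyapunov_eq P Q"
      then show "\<forall>x. ((\<lambda>t. blinfun_apply (quotient P t) x) \<longlongrightarrow> blinfun_apply Q x) (at_right 0)"
        using lyapunov_eq_strong_limit S.adjoint_strongly_continuous[OF refl] by blast
    qed
    finally show ?thesis unfolding lyapunov_generator_iff .
  qed
  then show "generator_wrt strong_operator_topology (implemented_semigroup T S) P =
      lyapunov_generator A B P" by (metis not_Some_eq)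
qed

end

theorem theorem3:
  fixes T :: "real \<Rightarrow> ('a::banach \<Rightarrow>\<^sub>L 'a)"
    and S :: "real \<Rightarrow> ('b::banach \<Rightarrow>\<^sub>L 'b)"
    and A :: "'a \<rightharpoonup> 'a"
    and B :: "'b \<rightharpoonup> 'b"
  assumes "C0_semigroup T" and "C0_semigroup S"
    and "A = generator T" and "B = generator S"
  shows
    "(\<forall>P :: 'a \<Rightarrow>\<^sub>L 'b dual.
        (P \<in> dom (lyapunov_generator A B) \<longleftrightarrow>
          (\<exists>Q :: 'a \<Rightarrow>\<^sub>L 'b dual. \<forall>x\<in>dom A. \<forall>y\<in>dom B.
             blinfun_apply (blinfun_apply P x) (the (B y)) +
             blinfun_apply (blinfun_apply P (the (A x))) y =
             blinfun_apply (blinfun_apply Q x) y)) \<and>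
        (\<forall>Q :: 'a \<Rightarrow>\<^sub>L 'b dual.
          (\<forall>x\<in>dom A. \<forall>y\<in>dom B.
             blinfun_apply (blinfun_apply P x) (the (B y)) +
             blinfun_apply (blinfun_apply P (the (A x))) y =
             blinfun_apply (blinfun_apply Q x) y) \<longrightarrow>
          lyapunov_generator A B P = Some Q)) \<and>
     generator_wrt weak_star_operator_topology (implemented_semigroup T S) =
       lyapunov_generator A B \<and>
     (reflexive_space TYPE('b) \<longrightarrow>
        generator_wrt strong_operator_topology (implemented_semigroup T S) =
          lyapunov_generator A B)"
proof -
  obtain \<delta>1 M1 where 1: "\<delta>1 > 0" "\<And>t. 0 \<le> t \<Longrightarrow> t \<le> \<delta>1 \<Longrightarrow> norm (T t) \<le> M1"
    using C0_semigroup_bounded[OF assms(1)] by blast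
  obtain \<delta>2 M2 where 2: "\<delta>2 > 0" "\<And>t. 0 \<le> t \<Longrightarrow> t \<le> \<delta>2 \<Longrightarrow> norm (S t) \<le> M2"
    using C0_semigroup_bounded[OF assms(2)] by blast
  \<comment> \<open>The shorter interval and the larger bound serve both semigroups.\<close>
  interpret implemented T S "min \<delta>1 \<delta>2" "max M1 M2"
    by unfold_locales (use assms(1,2) 1 2 in \<open>auto simp: le_max_iff_disj\<close>)
  \<comment> \<open>With the identity folded into \<open>lyapunov_generator A B P = Some Q\<close>,
    part (i) only unfolds membership in a domain.\<close>
  show ?thesis
    unfolding assms(3,4) lyapunov_eq_def[symmetric] lyapunov_generator_iff[symmetric]
    using weak_star_generator strong_generator by blast
qed

end
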